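(* Let $G$ be a finite connected $4$-valent vertex-transitive graph containing at least one edge of type $1$. Then $D(G)=2$, unless $G$ is isomorphic to $K_4\square K_2$.
   Context: Let $A=\operatorname{Aut}G$ and, for a vertex $v$, let $A_v$ be its stabiliser, acting on the neighbourhood $N(v)$. The type of an edge $uv$ is the size of the orbit of $u$ under $A_v$ acting on $N(v)$ (independent of the endpoint chosen). $D(G)$ is the distinguishing number: the least number of colours in a vertex colouring of $G$ preserved by no non-identity automorphism. $\square$ denotes the Cartesian product. *)

theory Defs
  imports "Graph_Theory.Graph_Theory" "HOL-Combinatorics.Permutations"
begin

text \<open>
  A finite simple graph is a \<^locale>\<open>pair_graph\<close>: an edge $uv$ is the pair of arcs
  $(u,v)$, $(v,u)$.
\<close>

text \<open>
  Automorphisms are permutations of the ambient type that fix everything outside the vertex set,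
  so that the identity automorphism is exactly \<^const>\<open>id\<close>.
\<close>

definition automorphisms :: "'a pair_pre_digraph \<Rightarrow> ('a \<Rightarrow> 'a) set" where
  "automorphisms G = {a. a permutes pverts G \<and>
     (\<forall>u \<in> pverts G. \<forall>v \<in> pverts G. (a u, a v) \<in> parcs G \<longleftrightarrow> (u, v) \<in> parcs G)}"

definition vertex_transitive :: "'a pair_pre_digraph \<Rightarrow> bool" where
  "vertex_transitive G \<longleftrightarrow>
     (\<forall>u \<in> pverts G. \<forall>v \<in> pverts G. \<exists>a \<in> automorphisms G. a u = v)"

definition vertex_stabiliser :: "'a pair_pre_digraph \<Rightarrow> 'a \<Rightarrow> ('a \<Rightarrow> 'a) set" where
  "vertex_stabiliser G v = {a \<in> automorphisms G. a v = v}"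

text \<open>
  For an arc $(u,v)$ the orbit below lies in the neighbourhood of $v$. The definition singles out
  the endpoint $v$; in a finite vertex-transitive graph the choice of endpoint does not matter.
\<close>

definition edge_type :: "'a pair_pre_digraph \<Rightarrow> 'a \<Rightarrow> 'a \<Rightarrow> nat" where
  "edge_type G u v = card {a u | a. a \<in> vertex_stabiliser G v}"

definition distinguishing_colouring :: "'a pair_pre_digraph \<Rightarrow> ('a \<Rightarrow> nat) \<Rightarrow> bool" where
  "distinguishing_colouring G c \<longleftrightarrow>
     (\<forall>a \<in> automorphisms G. (\<forall>v \<in> pverts G. c (a v) = c v) \<longrightarrow> a = id)"

definition distinguishing_number :: "'a pair_pre_digraph \<Rightarrow> nat" where
  "distinguishing_number G =
     (LEAST k. \<exists>c. c ` pverts G \<subseteq> {..<k} \<and> distinguishing_colouring G c)"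

definition cartesian_product ::
    "'a pair_pre_digraph \<Rightarrow> 'b pair_pre_digraph \<Rightarrow> ('a \<times> 'b) pair_pre_digraph" (infixl "\<box>" 70) where
  "G \<box> H = \<lparr> pverts = pverts G \<times> pverts H,
     parcs = {((u, x), (v, y)) | u x v y.
       (u = v \<and> u \<in> pverts G \<and> (x, y) \<in> parcs H) \<or>
       ((u, v) \<in> parcs G \<and> x = y \<and> x \<in> pverts H)} \<rparr>"

definition complete_graph :: "nat \<Rightarrow> nat pair_pre_digraph" where
  "complete_graph n = \<lparr> pverts = {..<n}, parcs = {(i, j). i < n \<and> j < n \<and> i \<noteq> j} \<rparr>"

lemma complete_digraph_complete_graph: "complete_digraph n (with_proj (complete_graph n))"
  by (auto simp: complete_digraph_pair_def complete_graph_def)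

end

theory Submission
  imports Defs
begin

text \<open>
  Call $u$ fixed at $v$ if every automorphism fixing $v$ fixes $u$; in a finite vertex-transitive graph this
  is an equivalence relation. A colouring is built by fixing vertices outward from a root: whenever a
  fixed vertex has neighbours that are not yet fixed, colour their classes so that these neighbours
  are told apart.

  If a vertex has two fixed neighbours, at most two others need to be told apart, and one black
  vertex in a new class suffices; the root class is the only one with two black vertices.

  Otherwise each $v$ has one fixed neighbour, its mate $m(v)$, and its stabiliser is transitive on
  the set $N(v)$ of the other three neighbours. The three new pairs $\{x, m(x)\}$ are told apart by
  the colours white-white, black-white and white-black, so black-black remains available to locate
  the root. What is left is to break the symmetries of a small initial part. This succeeds unless
  $m$ preserves $N$ and the quotient by $m$ is $K_4$, where the graph is either the exception
  $K_4 \mathbin{\Box} K_2$ or has twin vertices whose transposition contradicts type 1.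
\<close>

section \<open>Extending partial colourings\<close>

text \<open>\<open>S\<close> is the set of black vertices of a 2-colouring and \<open>F\<close> a
  set of vertices already known to be fixed. The parameter \<open>F\<close> lets a colouring be
  completed in stages; \<open>F = {}\<close> is the goal.\<close>

definition distinguishes_over :: "'a set \<Rightarrow> ('a \<Rightarrow> 'a) set \<Rightarrow> 'a set \<Rightarrow> 'a set \<Rightarrow> bool" where
  "distinguishes_over V A F S \<longleftrightarrow>
     (\<forall>a \<in> A. (\<forall>x \<in> V. a x \<in> S \<longleftrightarrow> x \<in> S) \<longrightarrow> (\<forall>x \<in> F. a x = x) \<longrightarrow> (\<forall>x \<in> V. a x = x))"

abbreviation distinguishing_set :: "'a set \<Rightarrow> ('a \<Rightarrow> 'a) set \<Rightarrow> 'a set \<Rightarrow> bool" where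
  "distinguishing_set V A \<equiv> distinguishes_over V A {}"

lemma distinguishing_setI:
  assumes "distinguishes_over V A F S"
    and "\<And>a x. a \<in> A \<Longrightarrow> (\<And>x. x \<in> V \<Longrightarrow> a x \<in> S \<longleftrightarrow> x \<in> S) \<Longrightarrow> x \<in> F \<Longrightarrow> a x = x"
  shows "distinguishing_set V A S"
proof -
  have "\<forall>x \<in> V. a x = x" if a: "a \<in> A" "\<forall>x \<in> V. a x \<in> S \<longleftrightarrow> x \<in> S" for a
  proof -
    have "\<forall>x \<in> F. a x = x" using assms(2)[OF a(1)] a(2) by simp
    then show ?thesis using assms(1) a unfolding distinguishes_over_def by simp
  qed
  then show ?thesis unfolding distinguishes_over_def by simp
qed

text \<open>
  \<^term>\<open>I\<close> is the invariant of the fixed sets \<^term>\<open>F\<close> met on the way; \<^term>\<open>P\<close> constrains the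
  colour pattern of each class \<^term>\<open>cl x\<close> outside the initial set.
\<close>

lemma extend_set:
  fixes cl :: "'a \<Rightarrow> 'a set"
  assumes fin: "finite V"
    and step: "\<And>F. I F \<Longrightarrow> F \<subset> V \<Longrightarrow> \<exists>D d. D \<noteq> {} \<and> D \<subseteq> V - F \<and> I (F \<union> D) \<and> d \<subseteq> D \<and>
        (\<forall>x \<in> D. cl x \<subseteq> D \<and> P x (d \<inter> cl x)) \<and>
        (\<forall>a \<in> A. \<forall>S. S \<inter> D = d \<longrightarrow> (\<forall>x \<in> V. a x \<in> S \<longleftrightarrow> x \<in> S) \<longrightarrow>
           (\<forall>x \<in> F. a x = x) \<longrightarrow> (\<forall>x \<in> D. a x = x))"
    and "I F" "F \<subseteq> V" "S0 \<subseteq> F"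
  shows "\<exists>S. S \<inter> F = S0 \<and> (\<forall>x \<in> V - F. P x (S \<inter> cl x)) \<and> distinguishes_over V A F S"
  using assms(3-5)
proof (induction "card (V - F)" arbitrary: F S0 rule: less_induct)
  case less
  show ?case
  proof (cases "F = V")
    case True
    moreover have "S0 \<inter> F = S0" using less.prems(3) by blast
    ultimately show ?thesis using True unfolding distinguishes_over_def by blast
  next
    case False
    then have "F \<subset> V" using less.prems(2) by blast
    from step[OF less.prems(1) this] obtain D d where D: "D \<noteq> {}" "D \<subseteq> V - F" "I (F \<union> D)" "d \<subseteq> D"
      and cl: "\<forall>x \<in> D. cl x \<subseteq> D \<and> P x (d \<inter> cl x)"
      and rigid: "\<forall>a \<in> A. \<forall>S. S \<inter> D = d \<longrightarrow> (\<forall>x \<in> V. a x \<in> S \<longleftrightarrow> x \<in> S) \<longrightarrow>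
           (\<forall>x \<in> F. a x = x) \<longrightarrow> (\<forall>x \<in> D. a x = x)"
      by (elim exE conjE)
    have "card (V - (F \<union> D)) < card (V - F)"
      using D(1,2) fin by (intro psubset_card_mono) auto
    moreover have "F \<union> D \<subseteq> V" "S0 \<union> d \<subseteq> F \<union> D" using D(2,4) less.prems(2,3) by blast+
    ultimately have "\<exists>S. S \<inter> (F \<union> D) = S0 \<union> d \<and> (\<forall>x \<in> V - (F \<union> D). P x (S \<inter> cl x)) \<and>
        distinguishes_over V A (F \<union> D) S"
      using less.hyps[of "F \<union> D" "S0 \<union> d"] D(3) by simp
    then obtain S where S: "S \<inter> (F \<union> D) = S0 \<union> d" "\<forall>x \<in> V - (F \<union> D). P x (S \<inter> cl x)"
      and fixed: "distinguishes_over V A (F \<union> D) S"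
      by blast
    \<comment> \<open>\<open>D\<close> and \<open>F\<close> are disjoint, so \<open>S\<close> agrees
      with \<open>S0\<close> on \<open>F\<close> and with \<open>d\<close> on \<open>D\<close>. The
      step therefore applies to \<open>S\<close>, whatever colours the later vertices
      receive.\<close>
    have SF: "S \<inter> F = S0" and SD: "S \<inter> D = d"
      using S(1) D(2,4) less.prems(3) by blast+
    have "P x (S \<inter> cl x)" if "x \<in> V - F" for x
    proof (cases "x \<in> D")
      case True
      then have "S \<inter> cl x = d \<inter> cl x" using cl SD by blast
      then show ?thesis using cl True by simp
    next
      case False
      then show ?thesis using S(2) that by blast
    qed
    moreover have "distinguishes_over V A F S"
      unfolding distinguishes_over_def
    proof (intro ballI impI)
      fix a x
      assume a: "a \<in> A" "\<forall>x \<in> V. a x \<in> S \<longleftrightarrow> x \<in> S" "\<forall>x \<in> F. a x = x" and x: "x \<in> V"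
      have "\<forall>x \<in> D. a x = x"
        using rigid[THEN bspec, OF a(1), THEN spec, THEN mp, OF SD, THEN mp, OF a(2), THEN mp, OF a(3)] .
      then have "\<forall>x \<in> F \<union> D. a x = x" using a(3) by blast
      from fixed[unfolded distinguishes_over_def, THEN bspec, OF a(1), THEN mp, OF a(2), THEN mp, OF this, THEN bspec, OF x]
      show "a x = x" .
    qed
    ultimately show ?thesis using SF by blast
  qed
qed

section \<open>Cubic graphs with an invariant perfect matching\<close>

lemma card_3_third:
  assumes "card X = 3" "x \<in> X" "y \<in> X" "x \<noteq> y"
  obtains z where "X = {x, y, z}" "z \<noteq> x" "z \<noteq> y"
proof -
  have "finite X" using assms(1) card.infinite by fastforce
  then have "card (X - {x, y}) = 1" using assms by (simp add: card_Diff_subset)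
  then obtain z where "X - {x, y} = {z}" by (rule card_1_singletonE)
  then show ?thesis using assms(2,3) by (intro that[of z]) auto
qed

lemma card_3_others:
  assumes "card X = 3" "x \<in> X"
  obtains y z where "X = {x, y, z}" "y \<noteq> x" "z \<noteq> x" "y \<noteq> z"
proof -
  have "X \<noteq> {x}" using assms by auto
  then obtain y where "y \<in> X" "x \<noteq> y" using assms(2) by blast
  then show ?thesis using card_3_third[OF assms, of y] that by metis
qed

text \<open>The case of exactly one fixed neighbour: \<open>m v\<close> is that neighbour and
  \<open>N v\<close> holds the other three. Connectedness uses both kinds of edges, since the
  N-edges alone may form several components.\<close>

locale matched_cubic =
  fixes V :: "'a set" and A :: "('a \<Rightarrow> 'a) set" and N :: "'a \<Rightarrow> 'a set" and m :: "'a \<Rightarrow> 'a"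
  assumes finite_V: "finite V"
    and N_V: "v \<in> V \<Longrightarrow> u \<in> N v \<Longrightarrow> u \<in> V"
    and card_N: "v \<in> V \<Longrightarrow> card (N v) = 3"
    and N_sym: "v \<in> V \<Longrightarrow> u \<in> N v \<Longrightarrow> v \<in> N u"
    and N_irrefl: "v \<in> V \<Longrightarrow> v \<notin> N v"
    and m_V: "v \<in> V \<Longrightarrow> m v \<in> V"
    and m_m: "v \<in> V \<Longrightarrow> m (m v) = v"
    and m_neq: "v \<in> V \<Longrightarrow> m v \<noteq> v"
    and m_N: "v \<in> V \<Longrightarrow> m v \<notin> N v"
    and A_V: "a \<in> A \<Longrightarrow> v \<in> V \<Longrightarrow> a v \<in> V"
    and A_inj: "a \<in> A \<Longrightarrow> inj_on a V"
    and A_N: "a \<in> A \<Longrightarrow> v \<in> V \<Longrightarrow> a ` N v = N (a v)"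
    and A_m: "a \<in> A \<Longrightarrow> v \<in> V \<Longrightarrow> a (m v) = m (a v)"
    and arc_transitive: "v \<in> V \<Longrightarrow> x \<in> N v \<Longrightarrow> w \<in> V \<Longrightarrow> y \<in> N w \<Longrightarrow> \<exists>a \<in> A. a v = w \<and> a x = y"
    and connected: "F \<subseteq> V \<Longrightarrow> F \<noteq> {} \<Longrightarrow> (\<And>v. v \<in> F \<Longrightarrow> N v \<subseteq> F) \<Longrightarrow> (\<And>v. v \<in> F \<Longrightarrow> m v \<in> F) \<Longrightarrow> F = V"
begin

lemma m_eq_iff: "x \<in> V \<Longrightarrow> y \<in> V \<Longrightarrow> m x = m y \<longleftrightarrow> x = y"
  by (metis m_m)

lemma N_A: "a \<in> A \<Longrightarrow> v \<in> V \<Longrightarrow> x \<in> N v \<Longrightarrow> a x \<in> N (a v)"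
  using A_N by blast

lemma A_N_iff:
  assumes "a \<in> A" "v \<in> V" "x \<in> V"
  shows "a x \<in> N (a v) \<longleftrightarrow> x \<in> N v"
proof
  assume "a x \<in> N (a v)"
  then obtain y where "y \<in> N v" "a y = a x" using A_N assms by (metis imageE)
  then show "x \<in> N v" using A_inj assms N_V by (metis inj_onD)
qed (use N_A assms in blast)

lemma A_eq_iff: "a \<in> A \<Longrightarrow> x \<in> V \<Longrightarrow> y \<in> V \<Longrightarrow> a x = a y \<longleftrightarrow> x = y"
  using A_inj by (auto dest: inj_onD)

text \<open>If \<open>m x\<close> were in \<open>N v\<close>, transitivity on \<open>N v\<close>
  would make \<open>m\<close> map \<open>N v\<close> to itself; but a fixed-point-free involution
  cannot act on three elements.\<close>

lemma mate_not_N: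
  assumes v: "v \<in> V" and x: "x \<in> N v"
  shows "m x \<notin> N v"
proof
  assume mx: "m x \<in> N v"
  have all: "m y \<in> N v" if y: "y \<in> N v" for y
  proof -
    obtain a where a: "a \<in> A" "a v = v" "a x = y" using arc_transitive v x y by metis
    then have "m y = a (m x)" using A_m N_V v x by auto
    then show ?thesis using N_A[OF a(1) v mx] a by simp
  qed
  obtain z where z: "N v = {x, m x, z}" "z \<noteq> x" "z \<noteq> m x"
    using card_3_third[OF card_N[OF v] x mx] m_neq N_V v x by metis
  have "m z \<in> {x, m x, z}" using all z by blast
  then show False using z m_m m_neq N_V v x by (metis insertE insertI1 insert_commute singletonD)
qed

lemma not_N_both: "v \<in> V \<Longrightarrow> x \<in> N v \<Longrightarrow> x \<notin> N (m v)"
  using mate_not_N[of x v] N_sym N_V m_V by blast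

text \<open>
  The new pairs of \<^term>\<open>p\<close>, \<^term>\<open>q\<close>, \<^term>\<open>r\<close> become white-white, black-white and white-black; if
  \<^term>\<open>p\<close> is already fixed, all new pairs are mixed.
\<close>

lemma extension_step:
  assumes F: "F \<subseteq> V" "\<And>x. x \<in> F \<Longrightarrow> m x \<in> F" and w: "w \<in> F" and Nw: "N w = {p, q, r}"
    and D: "D = (N w - F) \<union> m ` (N w - F)"
    and d: "d = ({q} - F) \<union> m ` ({r} - F)"
  shows "D \<inter> F = {}" "D \<subseteq> V" "\<And>x. x \<in> D \<Longrightarrow> m x \<in> D" "d \<subseteq> D"
    "\<And>x. x \<in> D \<Longrightarrow> \<not> (x \<in> d \<and> m x \<in> d)"
    "\<And>x. x \<in> D \<Longrightarrow> p \<in> F \<Longrightarrow> x \<in> d \<longleftrightarrow> m x \<notin> d"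
    "\<And>a S. a \<in> A \<Longrightarrow> S \<inter> D = d \<Longrightarrow> (\<And>x. x \<in> V \<Longrightarrow> a x \<in> S \<longleftrightarrow> x \<in> S) \<Longrightarrow>
       (\<And>x. x \<in> F \<Longrightarrow> a x = x) \<Longrightarrow> (\<And>x. x \<in> D \<Longrightarrow> a x = x)"
proof -
  have wV: "w \<in> V" using w F by blast
  have pqr: "p \<in> V" "q \<in> V" "r \<in> V" "p \<noteq> q" "p \<noteq> r" "q \<noteq> r"
    using N_V[OF wV] Nw card_N[OF wV] by (auto simp: card_insert_if split: if_splits)
  have mpqr: "m x \<noteq> y" if "x \<in> {p, q, r}" "y \<in> {p, q, r}" for x y
    using mate_not_N[OF wV] Nw that by blast
  have mF: "m x \<in> F \<longleftrightarrow> x \<in> F" if "x \<in> V" for x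
    using F m_m that by metis
  show disj: "D \<inter> F = {}" using mF pqr unfolding D Nw by auto
  show "D \<subseteq> V" using pqr m_V unfolding D Nw by auto
  show "\<And>x. x \<in> D \<Longrightarrow> m x \<in> D" using pqr m_m unfolding D Nw by auto
  show "d \<subseteq> D" unfolding D d Nw by auto
  \<comment> \<open>By \<open>mate_not_N\<close> the mate of a neighbour of \<open>w\<close> is not
    again a neighbour of \<open>w\<close>, so the two parts of \<open>d\<close> do not interfere:
    the colours of \<open>x\<close> and \<open>m x\<close> reveal which of \<open>p\<close>,
    \<open>q\<close>, \<open>r\<close> the vertex \<open>x\<close> is.\<close>
  have d1: "x \<in> d \<longleftrightarrow> x = q" "m x \<in> d \<longleftrightarrow> x = r" if "x \<in> N w - F" for x
    using that mpqr m_eq_iff pqr unfolding d Nw by auto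
  have D_cases: "\<exists>y. y \<in> N w - F \<and> (x = y \<or> x = m y \<and> m x = y)" if "x \<in> D" for x
    using that m_m N_V[OF wV] unfolding D by blast
  show "\<not> (x \<in> d \<and> m x \<in> d)" if "x \<in> D" for x
    using D_cases[OF that] d1 pqr(6) by metis
  show "x \<in> d \<longleftrightarrow> m x \<notin> d" if x: "x \<in> D" "p \<in> F" for x
  proof -
    obtain y where y: "y \<in> N w - F" "x = y \<or> x = m y \<and> m x = y" using D_cases[OF x(1)] by blast
    then have "y = q \<or> y = r" using x(2) Nw by auto
    then show ?thesis using y d1[OF y(1)] pqr(6) by metis
  qed
  show "a x = x" if a: "a \<in> A" and S: "S \<inter> D = d"
    and pres: "\<And>x. x \<in> V \<Longrightarrow> a x \<in> S \<longleftrightarrow> x \<in> S"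
    and fixF: "\<And>x. x \<in> F \<Longrightarrow> a x = x" and x: "x \<in> D" for a S x
  proof -
    have K: "a y = y" if y: "y \<in> N w - F" for y
    proof -
      have yV: "y \<in> V" using y N_V wV by blast
      have "a y \<in> N w" using N_A[OF a wV] y fixF[OF w] by auto
      moreover have "a y \<notin> F" using fixF A_eq_iff[OF a] F(1) yV y A_V[OF a] by (metis DiffD2 subsetD)
      ultimately have ay: "a y \<in> N w - F" by blast
      have "y \<in> D" "m y \<in> D" "a y \<in> D" "m (a y) \<in> D" using y ay unfolding D by auto
      then have "y = q \<longleftrightarrow> a y = q" "y = r \<longleftrightarrow> a y = r"
        using d1[OF y] d1[OF ay] S pres[OF yV] pres[OF m_V[OF yV]] A_m[OF a yV] by auto
      then show ?thesis using y ay Nw by auto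
    qed
    then show ?thesis using x A_m[OF a] N_V wV unfolding D by auto
  qed
qed

lemma obtain_unclosed:
  assumes "F \<subset> V" "F \<noteq> {}" "\<And>x. x \<in> F \<Longrightarrow> m x \<in> F"
  obtains w where "w \<in> F" "\<not> N w \<subseteq> F"
  using connected[of F] assms by blast

text \<open>All black-black pairs of \<open>S\<close> lie in \<open>F\<close>, so an automorphism
  preserving \<open>S\<close> maps the black-black pairs of the initial part among themselves. This
  is what locates the root.\<close>

lemma extend_without_double:
  assumes F: "F \<subseteq> V" "F \<noteq> {}" "\<forall>x \<in> F. m x \<in> F" and "S0 \<subseteq> F"
  obtains S where "S \<inter> F = S0" "\<And>x. x \<in> V - F \<Longrightarrow> \<not> (x \<in> S \<and> m x \<in> S)"
    "distinguishes_over V A F S"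
proof -
  let ?I = "\<lambda>F. F \<noteq> {} \<and> (\<forall>x \<in> F. m x \<in> F)"
  let ?P = "\<lambda>x T. \<not> (x \<in> T \<and> m x \<in> T)"
  have "\<exists>S. S \<inter> F = S0 \<and> (\<forall>x \<in> V - F. ?P x (S \<inter> {x, m x})) \<and>
        distinguishes_over V A F S"
  proof (rule extend_set[where I = ?I and P = ?P, OF finite_V])
    fix F assume F: "?I F" "F \<subset> V"
    then obtain w where w: "w \<in> F" "\<not> N w \<subseteq> F" using obtain_unclosed by blast
    then obtain p q r where Nw: "N w = {p, q, r}" using card_N F by (metis card_3_iff psubsetD)
    define D where "D = (N w - F) \<union> m ` (N w - F)"
    define d where "d = ({q} - F) \<union> m ` ({r} - F)"
    have sub: "F \<subseteq> V" and mF: "\<And>x. x \<in> F \<Longrightarrow> m x \<in> F" using F by auto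
    note step = extension_step[OF sub mF w(1) Nw D_def d_def]
    have "D \<noteq> {}" using w unfolding D_def by blast
    moreover have "\<forall>x \<in> D. {x, m x} \<subseteq> D \<and> ?P x (d \<inter> {x, m x})"
      using step(3,5) by blast
    moreover have "?I (F \<union> D)" using F(1) step(3) by blast
    moreover have "D \<subseteq> V - F" using step(1,2) by blast
    moreover have "\<forall>a \<in> A. \<forall>S. S \<inter> D = d \<longrightarrow> (\<forall>x \<in> V. a x \<in> S \<longleftrightarrow> x \<in> S) \<longrightarrow>
           (\<forall>x \<in> F. a x = x) \<longrightarrow> (\<forall>x \<in> D. a x = x)"
      using step(7) by blast
    ultimately show "\<exists>D d. D \<noteq> {} \<and> D \<subseteq> V - F \<and> ?I (F \<union> D) \<and> d \<subseteq> D \<and>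
        (\<forall>x \<in> D. {x, m x} \<subseteq> D \<and> ?P x (d \<inter> {x, m x})) \<and>
        (\<forall>a \<in> A. \<forall>S. S \<inter> D = d \<longrightarrow> (\<forall>x \<in> V. a x \<in> S \<longleftrightarrow> x \<in> S) \<longrightarrow>
           (\<forall>x \<in> F. a x = x) \<longrightarrow> (\<forall>x \<in> D. a x = x))"
      using step(4) by blast
  qed (use assms in auto)
  then obtain S where S: "S \<inter> F = S0" "\<forall>x \<in> V - F. ?P x (S \<inter> {x, m x})"
    "distinguishes_over V A F S"
    by blast
  show ?thesis
  proof (rule that[of S])
    show "S \<inter> F = S0" by (fact S(1))
    show "\<not> (x \<in> S \<and> m x \<in> S)" if "x \<in> V - F" for x using S(2) that by auto
  qed (fact S(3))
qed

section \<open>The twisted case: the matching carries no N-edge to an N-edge\<close>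

lemma distinct_N: "N v = {x, y, z} \<Longrightarrow> v \<in> V \<Longrightarrow> x \<noteq> y \<and> x \<noteq> z \<and> y \<noteq> z"
  using card_N[of v] by (auto simp: card_insert_if split: if_splits)

text \<open>Any N-arc can be moved to any other, so \<open>m\<close> carries either all N-edges to
  N-edges or none: the ladder case and the twisted case.\<close>

lemma ladder_invariant:
  assumes "v \<in> V" "x \<in> N v" "w \<in> V" "y \<in> N w" "m x \<in> N (m v)"
  shows "m y \<in> N (m w)"
proof -
  obtain a where a: "a \<in> A" "a v = w" "a x = y" using arc_transitive assms by metis
  then have "a (m x) \<in> N (a (m v))" using N_A m_V assms by blast
  then show ?thesis using a A_m N_V assms by metis
qed

lemma mate_apart:
  assumes v: "v \<in> V" and x: "x \<in> insert v (N v)" and z: "z \<in> insert v (N v)"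
  shows "m x \<noteq> z"
proof
  assume e: "m x = z"
  have "x \<in> V" using v x N_V by blast
  then have "m z = x" using e m_m by blast
  then show False using v x z e m_neq m_N mate_not_N by (metis insertE)
qed

text \<open>In the twisted case \<open>r y\<close> is the only N-edge within the pairs of
  \<open>r\<close> and \<open>y\<close>, so recognising these two pairs determines the edge up to
  reversal. Without triangles the other neighbours of \<open>r\<close> and of \<open>y\<close> are
  distinct.\<close>

lemma distinguishing_set_triangle_free:
  assumes twisted: "\<forall>v \<in> V. \<forall>x \<in> N v. m x \<notin> N (m v)"
    and r: "r \<in> V" and y: "y \<in> N r" and tri: "N r \<inter> N y = {}"
  shows "\<exists>S. distinguishing_set V A S"
proof -
  note twisted = twisted[rule_format]
  have yV: "y \<in> V" using N_V r y by blast
  have ry: "r \<in> N y" using N_sym r y by blast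
  \<comment> \<open>If the mate of a further neighbour of \<open>r\<close> lies in
    \<open>N y\<close>, such a neighbour is named \<open>y3\<close> and its mate \<open>u\<close>.
    Blackening \<open>m y3\<close> and \<open>u\<close>, which may be the same vertex, then leaves
    \<open>y2\<close>, \<open>m y2\<close> and \<open>u2\<close> white.\<close>
  have "\<exists>y2 y3 u. N r = {y, y2, y3} \<and> u \<in> N y \<and> u \<noteq> r \<and> (u = m y3 \<or> m y2 \<notin> N y \<and> m y3 \<notin> N y)"
  proof -
    obtain y2 y3 where Nr: "N r = {y, y2, y3}" using card_3_others card_N r y by metis
    obtain u where u: "u \<in> N y" "u \<noteq> r" using card_3_others[OF card_N[OF yV] ry] by blast
    have nr: "m z \<noteq> r" if "z \<in> N r" for z
      using that m_N m_m r N_V by metis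
    consider "m y3 \<in> N y" | "m y2 \<in> N y" | "m y2 \<notin> N y" "m y3 \<notin> N y" by blast
    then show ?thesis
    proof cases
      case 1
      then show ?thesis using Nr nr[of y3] by (intro exI[of _ y2] exI[of _ y3] exI[of _ "m y3"]) auto
    next
      case 2
      then show ?thesis using Nr nr[of y2] by (intro exI[of _ y3] exI[of _ y2] exI[of _ "m y2"]) auto
    next
      case 3
      then show ?thesis using Nr u by blast
    qed
  qed
  then obtain y2 y3 u where Nr: "N r = {y, y2, y3}" and u: "u \<in> N y" "u \<noteq> r"
    and c: "u = m y3 \<or> m y2 \<notin> N y \<and> m y3 \<notin> N y" by blast
  obtain u2 where Ny: "N y = {r, u, u2}" and u2: "u2 \<noteq> r" "u2 \<noteq> u"
    using card_3_third[OF card_N[OF yV] ry u(1)] u(2) by metis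
  have V: "r \<in> V" "y \<in> V" "y2 \<in> V" "y3 \<in> V" "u \<in> V" "u2 \<in> V"
    using N_V[OF r] N_V[OF yV] Nr Ny r by auto
  note mV = V[THEN m_V] and mm = V[THEN m_m] and mneq = V[THEN m_neq]
  have neq: "y \<noteq> y2" "y \<noteq> y3" "y2 \<noteq> y3" "y \<noteq> r" "y2 \<noteq> r" "y3 \<noteq> r" "u \<noteq> y" "u2 \<noteq> y"
    using distinct_N[OF Nr r] N_irrefl[OF r] N_irrefl[OF yV] Nr Ny by auto
  have tri': "u \<noteq> y2" "u \<noteq> y3" "u2 \<noteq> y2" "u2 \<noteq> y3" using tri Nr Ny by auto
  have par: "m y \<noteq> y2" "m y \<noteq> y3" "m y2 \<noteq> y" "m y2 \<noteq> y3" "m y3 \<noteq> y" "m y3 \<noteq> y2"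
    "m r \<noteq> y" "m r \<noteq> y2" "m r \<noteq> y3" "m y \<noteq> r" "m y2 \<noteq> r" "m y3 \<noteq> r"
    "m r \<noteq> u" "m r \<noteq> u2" "m u \<noteq> r" "m u \<noteq> u2" "m u2 \<noteq> r" "m u2 \<noteq> u"
    "m y \<noteq> u" "m y \<noteq> u2" "m u \<noteq> y" "m u2 \<noteq> y"
    using mate_apart[OF r, unfolded Nr] mate_apart[OF yV, unfolded Ny] by simp_all
  \<comment> \<open>The black-black pairs are those of \<^term>\<open>r\<close> and \<^term>\<open>y\<close>;
    they cannot be swapped, since only \<^term>\<open>y\<close> has a neighbour coloured black with a white
    mate.\<close>
  define S0 where "S0 = {r, m r, y, m y, m y3, u}"
  define F where "F = {r, y, y2, y3, u, u2} \<union> m ` {r, y, y2, y3, u, u2}"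
  have "F \<subseteq> V" "F \<noteq> {}" "\<forall>x \<in> F. m x \<in> F" "S0 \<subseteq> F"
    using V mV mm unfolding F_def S0_def by auto
  then obtain S where S: "S \<inter> F = S0" "\<And>x. x \<in> V - F \<Longrightarrow> \<not> (x \<in> S \<and> m x \<in> S)"
    and ext: "distinguishes_over V A F S"
    by (rule extend_without_double) blast
  have SF: "x \<in> S \<longleftrightarrow> x \<in> S0" if "x \<in> F" for x using S(1) that by blast
  have c2: "u2 \<noteq> m y3" "u \<noteq> m y2" using c Ny u2 par m_eq_iff V neq by auto
  have colour: "r \<in> S" "m r \<in> S" "y \<in> S" "m y \<in> S" "y2 \<notin> S" "m y2 \<notin> S" "y3 \<notin> S" "m y3 \<in> S"
    "u \<in> S" "m u \<notin> S" "u2 \<notin> S"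
    using neq tri' par par[symmetric] u u2 c2 m_eq_iff V mm mneq
    by (simp_all add: SF F_def S0_def)
  define Z where "Z = {r, m r, y, m y}"
  have Z: "x \<in> Z \<longleftrightarrow> x \<in> S \<and> m x \<in> S" if x: "x \<in> V" for x
  proof
    assume "x \<in> Z"
    then show "x \<in> S \<and> m x \<in> S" using colour(1-4) mm(1,2) unfolding Z_def by auto
  next
    assume xS: "x \<in> S \<and> m x \<in> S"
    then have "x \<in> F" using S(2) x by blast
    then consider "x \<in> Z" | "x \<in> {y2, y3, u, u2}" | z where "z \<in> {y2, y3, u, u2}" "x = m z"
      unfolding F_def Z_def by blast
    then show "x \<in> Z"
    proof cases
      case 2
      then show ?thesis using xS colour(5-11) by auto
    next
      case 3
      then have "z \<in> S" "m z \<in> S" using xS mm by auto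
      then show ?thesis using 3(1) colour(5-11) by auto
    qed
  qed
  \<comment> \<open>\<open>mate_not_N\<close> and \<open>not_N_both\<close> exclude the diagonals
    between the two pairs, and \<open>twisted\<close> excludes the edge between \<open>m r\<close>
    and \<open>m y\<close>.\<close>
  have edges: "x = r \<and> z = y \<or> x = y \<and> z = r" if "x \<in> Z" "z \<in> Z" "z \<in> N x" for x z
  proof -
    have "m r \<notin> N y" "m y \<notin> N r" "r \<notin> N (m y)" "y \<notin> N (m r)" "m r \<notin> N (m y)" "m y \<notin> N (m r)"
      "m r \<notin> N r" "m y \<notin> N y" "r \<notin> N (m r)" "y \<notin> N (m y)" "r \<notin> N r" "y \<notin> N y"
      "m r \<notin> N (m r)" "m y \<notin> N (m y)"
      using mate_not_N[OF r y] mate_not_N[OF yV ry] twisted[OF r y] twisted[OF yV ry] V mV mm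
        m_N[OF V(1)] m_N[OF V(2)] m_N[OF mV(1)] m_N[OF mV(2)] N_irrefl not_N_both[OF r y]
        not_N_both[OF yV ry] by auto
    then show ?thesis using that unfolding Z_def by auto
  qed
  have "distinguishing_set V A S"
  proof (rule distinguishing_setI[OF ext])
    fix a x
    assume a: "a \<in> A" and pres: "\<And>x. x \<in> V \<Longrightarrow> a x \<in> S \<longleftrightarrow> x \<in> S" and x: "x \<in> F"
    have presm: "m (a x) \<in> S \<longleftrightarrow> m x \<in> S" if "x \<in> V" for x
      using pres[OF m_V[OF that]] A_m[OF a that] by simp
    have "a r \<in> Z" "a y \<in> Z" using Z V A_V[OF a] pres presm colour by auto
    moreover have "a y \<in> N (a r)" using N_A[OF a r y] .
    ultimately have "a r = r \<and> a y = y \<or> a r = y \<and> a y = r" using edges by blast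
    moreover have "\<not> (a r = y \<and> a y = r)"
    proof
      assume "a r = y \<and> a y = r"
      then have "a u \<in> {y, y2, y3}" using N_A[OF a yV u(1)] Nr by simp
      moreover have "a u \<in> S" "m (a u) \<notin> S" using pres presm colour V by auto
      ultimately show False using colour by auto
    qed
    ultimately have ar: "a r = r" "a y = y" by auto
    have "a y2 \<in> {y, y2, y3}" "a y3 \<in> {y, y2, y3}" "a u \<in> {r, u, u2}" "a u2 \<in> {r, u, u2}"
      using N_A[OF a r] N_A[OF a yV] ar Nr Ny by auto
    \<comment> \<open>With \<open>r\<close> and \<open>y\<close> fixed, \<open>y2\<close> and
      \<open>y3\<close> differ in the colour of their mates, \<open>u\<close> and \<open>u2\<close>
      in their own.\<close>
    then have "a y2 = y2" "a y3 = y3" "a u = u" "a u2 = u2"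
      using ar A_eq_iff[OF a] V neq u u2 presm pres colour by (metis insertE singletonD)+
    then show "a x = x" using x ar A_m[OF a] V unfolding F_def by auto
  qed
  then show ?thesis by blast
qed

text \<open>An automorphism fixing \<open>v\<close> and taking \<open>x\<close> to the third
  neighbour turns the related pair into a second one. Two pairs in a triple share some
  \<open>c\<close>, which is thus related to both other neighbours; by transitivity \<open>c\<close>
  can be moved to any \<open>z\<close>.\<close>

lemma common_neighbours_invariant:
  assumes equivariant: "\<And>a x y. a \<in> A \<Longrightarrow> x \<in> V \<Longrightarrow> y \<in> V \<Longrightarrow> R x y \<Longrightarrow> R (a x) (a y)"
    and sym: "\<And>x y. x \<in> V \<Longrightarrow> y \<in> V \<Longrightarrow> R x y \<Longrightarrow> R y x"
    and v: "v \<in> V" and x: "x \<in> N v" "y \<in> N v" "x \<noteq> y" and R: "R x y"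
    and w: "w \<in> V" and z: "z \<in> N w" "z' \<in> N w" "z \<noteq> z'"
  shows "R z z'"
proof -
  obtain u where Nv: "N v = {x, y, u}" "u \<noteq> x" "u \<noteq> y"
    using card_3_third[OF card_N[OF v] x] by metis
  have V: "x \<in> V" "y \<in> V" "u \<in> V" using N_V[OF v] Nv by auto
  obtain a where a: "a \<in> A" "a v = v" "a x = u" using arc_transitive v Nv by blast
  have "R u (a y)" using equivariant[OF a(1) V(1,2) R] a by simp
  moreover have "a y \<in> {x, y}" using N_A[OF a(1) v x(2)] a A_eq_iff[OF a(1) V(1,2)] x(3) Nv by auto
  ultimately have "R u x \<or> R u y" by auto
  then have "\<exists>c \<in> N v. \<forall>d \<in> N v - {c}. R c d"
    using R sym[OF V(1,2)] sym[OF V(3,1)] sym[OF V(3,2)] Nv by auto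
  then obtain c where c: "c \<in> N v" "\<And>d. d \<in> N v \<Longrightarrow> d \<noteq> c \<Longrightarrow> R c d" by blast
  obtain b where b: "b \<in> A" "b v = w" "b c = z" using arc_transitive v c(1) w z(1) by blast
  have "z' \<in> b ` N v" using A_N[OF b(1) v] b(2) z(2) by simp
  then obtain d where d: "d \<in> N v" "b d = z'" by blast
  then have "R c d" using c(2) b(3) z(3) by blast
  then show ?thesis using equivariant[OF b(1)] c(1) d b(3) N_V[OF v] by metis
qed

text \<open>Thus a single N-triangle makes every component of the N-edges a copy of K_4.\<close>

lemma N_common_invariant:
  assumes "v \<in> V" "x \<in> N v" "y \<in> N v" "y \<in> N x" "w \<in> V" "z \<in> N w" "z' \<in> N w" "z \<noteq> z'"
  shows "z' \<in> N z"
proof (rule common_neighbours_invariant[where R = "\<lambda>x y. y \<in> N x"])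
  show "x \<noteq> y" using assms N_irrefl N_V by blast
qed (use assms N_A N_sym in auto)

text \<open>The N-components are copies of K_4, and in the twisted case two of them are joined by at
  most one mate edge. This limits the N-edges among a few chosen pairs enough to recognise the root
  pair by them.\<close>

lemma distinguishing_set_triangle:
  assumes twisted: "\<forall>v \<in> V. \<forall>x \<in> N v. m x \<notin> N (m v)"
    and tri: "v \<in> V" "x \<in> N v" "y \<in> N v" "y \<in> N x"
  shows "\<exists>S. distinguishing_set V A S"
proof -
  note twisted = twisted[rule_format]
  have K4: "y \<in> N x" if "w \<in> V" "x \<in> N w" "y \<in> N w" "x \<noteq> y" for w x y
    using N_common_invariant tri that by blast
  define r where "r = v"
  define s where "s = m r"
  have r: "r \<in> V" "m s = r" and s: "s \<in> V" "m r = s" "r \<noteq> s"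
    using tri m_V m_m m_neq[of v] unfolding s_def r_def by auto
  obtain y1 y2 y3 where Ns: "N s = {y1, y2, y3}" using card_N[OF s(1)] by (auto simp: card_3_iff)
  have y1V: "y1 \<in> V" using N_V[OF s(1)] Ns by blast
  \<comment> \<open>If \<open>m x1\<close> and \<open>m x2\<close> were both adjacent to
    \<open>m y1\<close>, they would lie in one K_4, and the edge \<open>x1 x2\<close> would violate
    \<open>twisted\<close>. So one of the two can be taken as \<open>x1\<close>, and the three
    black-black pairs do not close up to a triangle.\<close>
  have "\<exists>x1 x2 x3. N r = {x1, x2, x3} \<and> m x1 \<notin> N (m y1)"
  proof -
    obtain x1 x2 x3 where Nr: "N r = {x1, x2, x3}" using card_N[OF r(1)] by (auto simp: card_3_iff)
    have "m x1 \<notin> N (m y1) \<or> m x2 \<notin> N (m y1)"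
    proof (rule ccontr)
      assume "\<not> ?thesis"
      then have "m x2 \<in> N (m x1)"
        using K4[OF m_V[OF y1V], of "m x1" "m x2"] distinct_N[OF Nr r(1)] m_eq_iff N_V[OF r(1)] Nr by auto
      moreover have "x2 \<in> N x1" using K4[OF r(1)] distinct_N[OF Nr r(1)] Nr by auto
      ultimately show False using twisted N_V[OF r(1)] Nr by auto
    qed
    then show ?thesis
    proof
      assume "m x2 \<notin> N (m y1)"
      moreover have "N r = {x2, x1, x3}" using Nr by auto
      ultimately show ?thesis by blast
    qed (use Nr in blast)
  qed
  then obtain x1 x2 x3 where Nr: "N r = {x1, x2, x3}" and far: "m x1 \<notin> N (m y1)" by blast
  have V: "x1 \<in> V" "x2 \<in> V" "x3 \<in> V" "y1 \<in> V" "y2 \<in> V" "y3 \<in> V"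
    using N_V[OF r(1)] N_V[OF s(1)] Nr Ns by auto
  note mV = V[THEN m_V] and mm = V[THEN m_m]
  have disj: "x \<noteq> y" "m x \<noteq> y" "m y \<noteq> x" if "x \<in> N r" "y \<in> N s" for x y
  proof -
    show "x \<noteq> y" using not_N_both[OF r(1)] that s(2) by blast
    show "m x \<noteq> y" using twisted[OF r(1)] that s(2) by blast
    then show "m y \<noteq> x" using m_m N_V[OF s(1)] that by blast
  qed
  have neq: "x1 \<noteq> x2" "x1 \<noteq> x3" "x2 \<noteq> x3" "y1 \<noteq> y2" "y1 \<noteq> y3" "y2 \<noteq> y3"
    using distinct_N[OF Nr r(1)] distinct_N[OF Ns s(1)] by auto
  have parx: "x \<noteq> r" "x \<noteq> s" "m x \<noteq> r" "m x \<noteq> s" if "x \<in> N r" for x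
    using mate_apart[OF r(1)] that s(2) r m_m N_irrefl N_V by (metis insertCI)+
  have pary: "y \<noteq> r" "y \<noteq> s" "m y \<noteq> r" "m y \<noteq> s" if "y \<in> N s" for y
    using mate_apart[OF s(1)] that r(2) s m_m N_irrefl N_V by (metis insertCI)+
  have apart: "m x \<noteq> x'" "x' \<noteq> m x" if "x \<in> N r \<and> x' \<in> N r \<or> x \<in> N s \<and> x' \<in> N s" for x x'
    using mate_apart[OF r(1)] mate_apart[OF s(1)] that by blast+
  have xy: "x1 \<in> N r" "x2 \<in> N r" "x3 \<in> N r" "y1 \<in> N s" "y2 \<in> N s" "y3 \<in> N s"
    using Nr Ns by auto
  \<comment> \<open>The black-black pairs form a path with the pair of \<^term>\<open>r\<close> and
    \<^term>\<open>s\<close> in the middle; \<^term>\<open>x3\<close> and \<^term>\<open>y3\<close> orient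
    it.\<close>
  define S0 where "S0 = {r, s, x1, m x1, y1, m y1, m x3, y3}"
  define F where "F = {r, s} \<union> {x1, x2, x3, y1, y2, y3} \<union> m ` {x1, x2, x3, y1, y2, y3}"
  have "F \<subseteq> V" "F \<noteq> {}" "\<forall>x \<in> F. m x \<in> F" "S0 \<subseteq> F"
    using V mV mm r s unfolding F_def S0_def by auto
  then obtain S where S: "S \<inter> F = S0" "\<And>x. x \<in> V - F \<Longrightarrow> \<not> (x \<in> S \<and> m x \<in> S)"
    and ext: "distinguishes_over V A F S"
    by (rule extend_without_double) blast
  have SF: "x \<in> S \<longleftrightarrow> x \<in> S0" if "x \<in> F" for x using S(1) that by blast
  have colour: "r \<in> S" "s \<in> S" "x1 \<in> S" "m x1 \<in> S" "y1 \<in> S" "m y1 \<in> S"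
    "x2 \<notin> S" "m x2 \<notin> S" "x3 \<notin> S" "m x3 \<in> S" "y2 \<notin> S" "m y2 \<notin> S" "y3 \<in> S" "m y3 \<notin> S"
    using neq xy disj disj[symmetric] parx pary apart m_eq_iff V
    by (simp_all add: SF F_def S0_def)
  define Z where "Z = {r, s, x1, m x1, y1, m y1}"
  have Z: "x \<in> Z \<longleftrightarrow> x \<in> S \<and> m x \<in> S" if x: "x \<in> V" for x
  proof
    assume "x \<in> Z"
    then show "x \<in> S \<and> m x \<in> S" using colour(1-6) mm(1,4) r s unfolding Z_def by auto
  next
    assume xS: "x \<in> S \<and> m x \<in> S"
    then have "x \<in> F" using S(2) x by blast
    then consider "x \<in> Z" | "x \<in> {x2, x3, y2, y3}" | z where "z \<in> {x2, x3, y2, y3}" "x = m z"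
      unfolding F_def Z_def by blast
    then show "x \<in> Z"
    proof cases
      case 2
      then show ?thesis using xS colour(7-14) by auto
    next
      case 3
      then have "z \<in> S" "m z \<in> S" using xS mm by auto
      then show ?thesis using 3(1) colour(7-14) by auto
    qed
  qed
  \<comment> \<open>The ends \<open>m x1\<close> and \<open>m y1\<close> of the path have no
    neighbour in \<open>Z\<close>, which tells the middle pair from the outer two.\<close>
  have edges: "z = r \<or> z = s" if "z \<in> Z" "p \<in> Z" "q \<in> Z" "p \<in> N z" "q \<in> N (m z)" for z p q
  proof -
    have b: "m y1 \<notin> N x1"
      using K4[OF V(1), of r "m y1"] N_sym[OF r(1) xy(1)] pary(3) xy twisted[OF s(1) xy(4)] r(2)
      by metis
    have c: "m x1 \<notin> N y1"
      using K4[OF V(4), of s "m x1"] N_sym[OF s(1) xy(4)] parx(4) xy twisted[OF r(1) xy(1)] s(2)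
      by metis
    have sym: "p \<in> N q \<longleftrightarrow> q \<in> N p" if "p \<in> V" "q \<in> V" for p q
      using N_sym that by blast
    have "r \<notin> N (m x1)" "s \<notin> N (m x1)" "x1 \<notin> N (m x1)" "m x1 \<notin> N (m x1)" "y1 \<notin> N (m x1)"
      "m y1 \<notin> N (m x1)"
      using sym[OF r(1) mV(1)] mate_not_N[OF r(1) xy(1)] sym[OF s(1) mV(1)] twisted[OF r(1) xy(1)] s(2)
        m_N[OF mV(1)] mm(1) N_irrefl[OF mV(1)] sym[OF V(4) mV(1)] c sym[OF mV(4) mV(1)] far
      by simp_all
    moreover have "r \<notin> N (m y1)" "s \<notin> N (m y1)" "x1 \<notin> N (m y1)" "m x1 \<notin> N (m y1)" "y1 \<notin> N (m y1)"
      "m y1 \<notin> N (m y1)"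
      using sym[OF s(1) mV(4)] mate_not_N[OF s(1) xy(4)] sym[OF r(1) mV(4)] twisted[OF s(1) xy(4)] r(2)
        m_N[OF mV(4)] mm(4) N_irrefl[OF mV(4)] sym[OF V(1) mV(4)] b far
      by simp_all
    ultimately show ?thesis using that mm(1,4) unfolding Z_def by fastforce
  qed
  have "distinguishing_set V A S"
  proof (rule distinguishing_setI[OF ext])
    fix a x
    assume a: "a \<in> A" and pres: "\<And>x. x \<in> V \<Longrightarrow> a x \<in> S \<longleftrightarrow> x \<in> S" and x: "x \<in> F"
    have presm: "m (a x) \<in> S \<longleftrightarrow> m x \<in> S" if "x \<in> V" for x
      using pres[OF m_V[OF that]] A_m[OF a that] by simp
    have as: "a s = m (a r)" using A_m[OF a r(1)] s by simp
    have "a r \<in> Z" "a x1 \<in> Z" "a y1 \<in> Z" using Z r V A_V[OF a] pres presm colour s by auto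
    then have "a r = r \<or> a r = s"
      using edges N_A[OF a r(1) xy(1)] N_A[OF a s(1) xy(4)] as by metis
    \<comment> \<open>\<open>y3\<close> is black with a white mate, and no neighbour of
      \<open>r\<close> has this pattern.\<close>
    moreover have "a r \<noteq> s"
    proof
      assume "a r = s"
      then have "a ` N r = N s" using A_N[OF a r(1)] by simp
      then obtain x where "x \<in> {x1, x2, x3}" "a x = y3" using xy(6) Nr by (metis imageE)
      then show False using pres presm colour V by auto
    qed
    ultimately have ar: "a r = r" "a s = s" using as s by auto
    have "a z \<in> {x1, x2, x3}" if "z \<in> {x1, x2, x3}" for z
      using N_A[OF a r(1)] ar Nr that by auto
    then have ax: "a x1 \<in> {x1, x2, x3}" "a x2 \<in> {x1, x2, x3}" "a x3 \<in> {x1, x2, x3}" by auto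
    have "a z \<in> {y1, y2, y3}" if "z \<in> {y1, y2, y3}" for z
      using N_A[OF a s(1)] ar Ns that by auto
    then have ay: "a y1 \<in> {y1, y2, y3}" "a y2 \<in> {y1, y2, y3}" "a y3 \<in> {y1, y2, y3}" by auto
    have "a x1 = x1" "a x2 = x2" "a x3 = x3" "a y1 = y1" "a y2 = y2" "a y3 = y3"
      using ax ay presm pres colour V by (metis insertE singletonD)+
    then show "a x = x" using x ar A_m[OF a] V unfolding F_def by auto
  qed
  then show ?thesis by blast
qed

section \<open>The ladder case and the quotient by the matching\<close>

text \<open>
  Adjacency in the quotient by \<^term>\<open>m\<close>.
\<close>

definition adj :: "'a \<Rightarrow> 'a \<Rightarrow> bool" where
  "adj x y \<longleftrightarrow> y \<in> N x \<or> m y \<in> N x"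

lemma N_adj: "y \<in> N x \<Longrightarrow> adj x y"
  unfolding adj_def by blast

lemma adj_A:
  assumes "a \<in> A" "x \<in> V" "y \<in> V"
  shows "adj (a x) (a y) \<longleftrightarrow> adj x y"
  using A_N_iff[OF assms] A_N_iff[OF assms(1,2) m_V[OF assms(3)]] A_m[OF assms(1,3)]
  unfolding adj_def by simp

lemma adj_m: "y \<in> V \<Longrightarrow> adj x (m y) \<longleftrightarrow> adj x y"
  unfolding adj_def using m_m by auto

end

text \<open>Here \<open>m\<close> preserves the N-edges, so any two pairs adjacent in the quotient
  are joined by two parallel N-edges, and the quotient is again cubic.\<close>

locale ladder = matched_cubic +
  assumes ladder: "\<And>v x. v \<in> V \<Longrightarrow> x \<in> N v \<Longrightarrow> m x \<in> N (m v)"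
begin

lemma N_m: "v \<in> V \<Longrightarrow> x \<in> N (m v) \<Longrightarrow> m x \<in> N v"
  using ladder[of "m v" x] m_V m_m by simp

lemma N_m_eq:
  assumes v: "v \<in> V"
  shows "N (m v) = m ` N v"
proof
  show "N (m v) \<subseteq> m ` N v"
  proof
    fix u assume u: "u \<in> N (m v)"
    then have "u = m (m u)" using m_m N_V[OF m_V[OF v]] by simp
    then show "u \<in> m ` N v" using N_m[OF v u] by blast
  qed
qed (use ladder v in blast)

lemma adj_sym:
  assumes "x \<in> V" "y \<in> V" "adj x y"
  shows "adj y x"
  using assms N_sym[of x] N_m[of y x] unfolding adj_def by blast

lemma adj_m_left:
  assumes "x \<in> V" "y \<in> V"
  shows "adj (m x) y \<longleftrightarrow> adj x y"
  using adj_sym adj_m m_V assms by metis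

text \<open>When every vertex of \<open>F\<close> has a neighbour in \<open>F\<close>, at most two
  neighbours of a vertex are new, and the two mixed patterns suffice. White-white pairs, as well as
  black-black ones, then occur only in the initial part and can serve as landmarks.\<close>

lemma extend_mixed:
  assumes F: "F \<subseteq> V" "F \<noteq> {}" "\<forall>x \<in> F. m x \<in> F" "S0 \<subseteq> F" "\<forall>x \<in> F. N x \<inter> F \<noteq> {}"
  obtains S where "S \<inter> F = S0" "\<And>x. x \<in> V - F \<Longrightarrow> x \<in> S \<longleftrightarrow> m x \<notin> S"
    "distinguishes_over V A F S"
proof -
  let ?I = "\<lambda>F. F \<noteq> {} \<and> (\<forall>x \<in> F. m x \<in> F) \<and> (\<forall>x \<in> F. N x \<inter> F \<noteq> {})"
  let ?P = "\<lambda>x T. x \<in> T \<longleftrightarrow> m x \<notin> T"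
  have "\<exists>S. S \<inter> F = S0 \<and> (\<forall>x \<in> V - F. ?P x (S \<inter> {x, m x})) \<and>
        distinguishes_over V A F S"
  proof (rule extend_set[where I = ?I and P = ?P, OF finite_V])
    fix F assume F: "?I F" "F \<subset> V"
    then obtain w where w: "w \<in> F" "\<not> N w \<subseteq> F" using obtain_unclosed by blast
    then obtain p where p: "p \<in> N w" "p \<in> F" using F by blast
    then obtain q r where Nw: "N w = {p, q, r}" using card_N F w(1) by (metis card_3_others psubsetD)
    define D where "D = (N w - F) \<union> m ` (N w - F)"
    define d where "d = ({q} - F) \<union> m ` ({r} - F)"
    have sub: "F \<subseteq> V" and mF: "\<And>x. x \<in> F \<Longrightarrow> m x \<in> F" using F by auto
    note step = extension_step[OF sub mF w(1) Nw D_def d_def]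
    have "D \<noteq> {}" using w unfolding D_def by blast
    moreover have "\<forall>x \<in> D. {x, m x} \<subseteq> D \<and> ?P x (d \<inter> {x, m x})"
      using step(3,6) p(2) by blast
    moreover have "?I (F \<union> D)"
    proof -
      have wV: "w \<in> V" using w(1) sub by blast
      \<comment> \<open>A new vertex is a neighbour of \<open>w\<close> or the mate of one; in the
        second case \<open>ladder\<close> makes \<open>m w\<close> its neighbour, and
        \<open>F\<close> is closed under \<open>m\<close>.\<close>
      have "N x \<inter> F \<noteq> {}" if "x \<in> D" for x
      proof -
        obtain y where y: "y \<in> N w" "x = y \<or> x = m y" using \<open>x \<in> D\<close> unfolding D_def by blast
        then have "w \<in> N y" using N_sym wV by blast
        then have "w \<in> N x \<or> m w \<in> N x" using y ladder N_V[OF wV y(1)] by blast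
        then show ?thesis using w(1) mF by blast
      qed
      then show ?thesis using F(1) step(3) by blast
    qed
    moreover have "D \<subseteq> V - F" using step(1,2) by blast
    moreover have "\<forall>a \<in> A. \<forall>S. S \<inter> D = d \<longrightarrow> (\<forall>x \<in> V. a x \<in> S \<longleftrightarrow> x \<in> S) \<longrightarrow>
           (\<forall>x \<in> F. a x = x) \<longrightarrow> (\<forall>x \<in> D. a x = x)"
      using step(7) by blast
    ultimately show "\<exists>D d. D \<noteq> {} \<and> D \<subseteq> V - F \<and> ?I (F \<union> D) \<and> d \<subseteq> D \<and>
        (\<forall>x \<in> D. {x, m x} \<subseteq> D \<and> ?P x (d \<inter> {x, m x})) \<and>
        (\<forall>a \<in> A. \<forall>S. S \<inter> D = d \<longrightarrow> (\<forall>x \<in> V. a x \<in> S \<longleftrightarrow> x \<in> S) \<longrightarrow>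
           (\<forall>x \<in> F. a x = x) \<longrightarrow> (\<forall>x \<in> D. a x = x))"
      using step(4) by blast
  qed (use assms in auto)
  then obtain S where S: "S \<inter> F = S0" "\<forall>x \<in> V - F. ?P x (S \<inter> {x, m x})"
    "distinguishes_over V A F S"
    by blast
  show ?thesis
  proof (rule that[of S])
    show "S \<inter> F = S0" by (fact S(1))
    show "x \<in> S \<longleftrightarrow> m x \<notin> S" if "x \<in> V - F" for x using S(2) that by auto
  qed (fact S(3))
qed

text \<open>Using white-white, black-white and white-black around \<open>v\<close> could leave an
  exchange of \<open>v\<close> and \<open>m v\<close>. So only the pair of \<open>x3\<close> is
  mixed, \<open>x1\<close> and \<open>x2\<close> are both white-white, and \<open>c\<close> has to
  separate them.\<close>

lemma distinguishing_set_of_private_neighbour: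
  assumes tri_free: "\<forall>v \<in> V. \<forall>x \<in> N v. \<forall>y \<in> N v. \<not> adj x y"
    and v: "v \<in> V" and x: "x1 \<in> N v" "x2 \<in> N v" and c: "c \<in> N x1" "\<not> adj x2 c"
  shows "\<exists>S. distinguishing_set V A S"
proof -
  note tri_free = tri_free[rule_format]
  have "x1 \<noteq> x2" using c N_adj by blast
  then obtain x3 where Nv: "N v = {x1, x2, x3}" using card_3_third card_N v x by metis
  have V: "v \<in> V" "x1 \<in> V" "x2 \<in> V" "x3 \<in> V" "c \<in> V"
    using v N_V[OF v] Nv N_V[OF _ c(1)] by auto
  note mV = V[THEN m_V] and mm = V[THEN m_m]
  have Nx: "v \<in> N x1" "v \<in> N x2" "v \<in> N x3" using N_sym[OF v] Nv by auto
  have neq: "x1 \<noteq> x2" "x1 \<noteq> x3" "x2 \<noteq> x3" "x1 \<noteq> v" "x2 \<noteq> v" "x3 \<noteq> v"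
    using distinct_N[OF Nv v] N_irrefl[OF v] Nv by auto
  have apart: "m x \<noteq> z" "z \<noteq> m x" if "x \<in> {v, x1, x2, x3}" "z \<in> {v, x1, x2, x3}" for x z
    using mate_apart[OF v] that unfolding Nv by blast+
  have tri: "\<not> adj x1 x1" "\<not> adj x1 x2" "\<not> adj x1 x3" "\<not> adj x2 x1" "\<not> adj x2 x2"
    using tri_free[OF v] Nv by auto
  have "c \<noteq> v" using c(2) Nx(2) N_adj by blast
  moreover have "m c \<noteq> v" using mate_apart[OF V(2)] c(1) Nx(1) by blast
  moreover have "c \<noteq> x3" using c(1) N_adj tri(3) by blast
  moreover have "m c \<noteq> x3" using c(1) N_adj tri(3) adj_m[OF V(5), of x1] by metis
  ultimately have cneq: "c \<noteq> v" "m c \<noteq> v" "c \<noteq> x3" "m c \<noteq> x3" by blast+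
  \<comment> \<open>Outside the initial part all pairs are mixed, so \<^term>\<open>v\<close> is located by
    black-black and \<^term>\<open>x1\<close> is told from \<^term>\<open>x2\<close> by its white-white
    neighbour \<^term>\<open>c\<close>.\<close>
  define S0 where "S0 = {v, m v, m x3}"
  define F where "F = {v, x1, x2, x3, c} \<union> m ` {v, x1, x2, x3, c}"
  have "F \<subseteq> V" "F \<noteq> {}" "\<forall>x \<in> F. m x \<in> F" "S0 \<subseteq> F"
    using V mV mm unfolding F_def S0_def by auto
  moreover have "\<forall>x \<in> F. N x \<inter> F \<noteq> {}"
  proof
    define L where "L = {v, x1, x2, x3, c}"
    have F: "F = L \<union> m ` L" unfolding F_def L_def by simp
    have L: "\<exists>z \<in> L. z \<in> N y" if "y \<in> L" for y
      using that Nx Nv N_sym[OF V(2) c(1)] unfolding L_def by auto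
    have LV: "L \<subseteq> V" using V unfolding L_def by blast
    fix x assume "x \<in> F"
    then consider "x \<in> L" | y where "y \<in> L" "x = m y" unfolding F by blast
    then show "N x \<inter> F \<noteq> {}"
    proof cases
      case 1
      then show ?thesis using L unfolding F by blast
    next
      case 2
      then obtain z where "z \<in> L" "z \<in> N y" using L by blast
      moreover then have "m z \<in> N x" using ladder 2 LV by blast
      ultimately show ?thesis unfolding F by blast
    qed
  qed
  ultimately obtain S where S: "S \<inter> F = S0" "\<And>x. x \<in> V - F \<Longrightarrow> x \<in> S \<longleftrightarrow> m x \<notin> S"
    and ext: "distinguishes_over V A F S"
    by (rule extend_mixed) blast
  have SF: "x \<in> S \<longleftrightarrow> x \<in> S0" if "x \<in> F" for x using S(1) that by blast
  have colour: "v \<in> S" "m v \<in> S" "x1 \<notin> S" "m x1 \<notin> S" "x2 \<notin> S" "m x2 \<notin> S"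
    "x3 \<notin> S" "m x3 \<in> S" "c \<notin> S" "m c \<notin> S"
    using neq apart cneq m_eq_iff V mm by (auto simp: SF F_def S0_def)
  have double: "x \<in> {v, m v}" if x: "x \<in> V" "x \<in> S" "m x \<in> S" for x
  proof -
    have "x \<in> F" using S(2) x by blast
    then show ?thesis using x(2,3) colour mm unfolding F_def by auto
  qed
  have empty: "x \<in> {x1, x2, m x1, m x2, c, m c}" if x: "x \<in> V" "x \<notin> S" "m x \<notin> S" for x
  proof -
    have "x \<in> F" using S(2) x by blast
    then show ?thesis using x(2,3) colour mm unfolding F_def by auto
  qed
  have "distinguishing_set V A S"
  proof (rule distinguishing_setI[OF ext])
    fix a x
    assume a: "a \<in> A" and pres: "\<And>x. x \<in> V \<Longrightarrow> a x \<in> S \<longleftrightarrow> x \<in> S" and x: "x \<in> F"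
    have presm: "m (a x) \<in> S \<longleftrightarrow> m x \<in> S" if "x \<in> V" for x
      using pres[OF m_V[OF that]] A_m[OF a that] by simp
    \<comment> \<open>The neighbours of \<open>m v\<close> are the mates of \<open>x1\<close>,
      \<open>x2\<close>, \<open>x3\<close>; none of them is white with a black mate, as
      \<open>x3\<close> is.\<close>
    have "a v \<noteq> m v"
    proof
      assume "a v = m v"
      then have "a x3 \<in> N (m v)" using N_A[OF a v, of x3] Nv by simp
      then have "m (a x3) \<in> {x1, x2, x3}" using N_m[OF v] Nv by blast
      moreover have "a x3 \<notin> S" "m (a x3) \<in> S" using pres presm colour V by auto
      ultimately show False using colour by auto
    qed
    moreover have "a v \<in> {v, m v}" using double[OF A_V[OF a v]] pres presm colour V by simp
    ultimately have av: "a v = v" by simp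
    have ax: "a z \<in> {x1, x2, x3}" if "z \<in> {x1, x2, x3}" for z
      using N_A[OF a v] av Nv that by auto
    have ac: "a c \<in> {x1, x2, m x1, m x2, c, m c}"
      using empty[OF A_V[OF a V(5)]] pres presm colour V by simp
    \<comment> \<open>Otherwise \<open>x2\<close> would be adjacent in the quotient to a white-white
      pair, but the pairs of \<open>x1\<close> and \<open>x2\<close> are excluded by
      \<open>tri_free\<close> and that of \<open>c\<close> by its choice.\<close>
    have "a x1 \<noteq> x2"
    proof
      assume "a x1 = x2"
      then have "adj x2 (a c)" using N_adj N_A[OF a V(2) c(1)] by simp
      then show False using ac c(2) tri adj_m V by auto
    qed
    moreover have "a x1 \<noteq> x3" "a x2 \<noteq> x3" using presm colour V by auto
    ultimately have a12: "a x1 = x1" "a x2 = x2" "a x3 = x3"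
      using ax[of x1] ax[of x2] ax[of x3] A_eq_iff[OF a] V neq by auto
    have "a c \<in> N x1" using N_A[OF a V(2) c(1)] a12 by simp
    then have "a c = c" using ac tri adj_m V N_adj[of "a c" x1] mate_not_N[OF V(2) c(1)] by auto
    then show "a x = x" using x av a12 A_m[OF a] V unfolding F_def by auto
  qed
  then show ?thesis by blast
qed

text \<open>The quotient has no triangle and any two neighbours of a vertex have the same
  neighbours, so it is K_{3,3} with sides \<open>{x1, x2, x3}\<close> and \<open>{r, p, q}\<close>.
  The graph has twelve vertices, and a colouring is written down explicitly.\<close>

lemma distinguishing_set_bipartite:
  assumes tri_free: "\<forall>v \<in> V. \<forall>x \<in> N v. \<forall>y \<in> N v. \<not> adj x y"
    and twins: "\<forall>v \<in> V. \<forall>x \<in> N v. \<forall>y \<in> N v. \<forall>c \<in> N x. adj y c"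
    and r: "r \<in> V"
  shows "\<exists>S. distinguishing_set V A S"
proof -
  note tri_free = tri_free[rule_format] and twins = twins[rule_format]
  obtain x1 x2 x3 where Nr: "N r = {x1, x2, x3}" using card_N[OF r] by (auto simp: card_3_iff)
  have xV: "x1 \<in> V" "x2 \<in> V" "x3 \<in> V" using N_V[OF r] Nr by auto
  have rx: "r \<in> N x1" using N_sym[OF r] Nr by blast
  obtain p q where Nx: "N x1 = {r, p, q}" using card_3_others[OF card_N[OF xV(1)] rx] by metis
  have V: "r \<in> V" "x1 \<in> V" "x2 \<in> V" "x3 \<in> V" "p \<in> V" "q \<in> V"
    using r xV N_V[OF xV(1)] Nx by auto
  note mV = V[THEN m_V] and mm = V[THEN m_m]
  define K where "K = {r, x1, x2, x3, p, q}"
  define F where "F = K \<union> m ` K"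
  have KV: "K \<subseteq> V" using V unfolding K_def by blast
  have mF: "m x \<in> F" if "x \<in> F" for x using that KV m_m unfolding F_def by fastforce
  have FV: "F \<subseteq> V" using KV m_V unfolding F_def by blast
  have F_adj: "z \<in> F" if "adj x z" "x = r \<or> x = x1" "z \<in> V" for x z
    using that Nr Nx m_m[OF that(3)] mF[of "m z"] unfolding adj_def F_def K_def by fastforce
  \<comment> \<open>By \<open>twins\<close>, what is next to one neighbour of \<open>r\<close> is
    next to \<open>x1\<close> in the quotient, and what is next to one neighbour of
    \<open>x1\<close> is next to \<open>r\<close>.\<close>
  have NK: "z \<in> F" if x: "x \<in> K" and z: "z \<in> N x" for x z
  proof -
    have zV: "z \<in> V" using N_V x z KV by blast
    consider "x \<in> N r" | "x \<in> N x1" using x Nr Nx unfolding K_def by blast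
    then show ?thesis
    proof cases
      case 1
      then show ?thesis using twins[OF r 1 _ z, of x1] F_adj zV Nr by blast
    next
      case 2
      then show ?thesis using twins[OF V(2) 2 _ z, of r] F_adj zV Nx by blast
    qed
  qed
  have "F = V"
  proof (rule connected[OF FV])
    show "N x \<subseteq> F" if xF: "x \<in> F" for x
    proof
      fix z assume z: "z \<in> N x"
      consider "x \<in> K" | y where "y \<in> K" "x = m y" using xF unfolding F_def by blast
      then show "z \<in> F"
      proof cases
        case 2
        then have "m z \<in> F" using N_m[of y z] NK z KV by blast
        moreover have "m (m z) = z" using m_m N_V z xF FV by blast
        ultimately show ?thesis using mF by metis
      qed (use NK z in blast)
    qed
  qed (use mF in \<open>auto simp: F_def K_def\<close>)
  have neq: "x1 \<noteq> x2" "x1 \<noteq> x3" "x2 \<noteq> x3" "r \<noteq> p" "r \<noteq> q" "p \<noteq> q"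
    using distinct_N[OF Nr r] distinct_N[OF Nx V(2)] by auto
  have apart: "m x \<noteq> z" if "x \<in> {x1, x2, x3} \<and> z \<in> {x1, x2, x3} \<or> x \<in> {r, p, q} \<and> z \<in> {r, p, q}" for x z
    using mate_apart[OF r] mate_apart[OF V(2)] that unfolding Nr Nx by blast
  have xz: "x \<noteq> z" "m x \<noteq> z" if "x \<in> {x1, x2, x3}" "z \<in> {r, p, q}" for x z
  proof -
    have "adj x1 z" "\<not> adj x1 x" using N_adj that Nx tri_free[OF r] Nr by auto
    then show "x \<noteq> z" "m x \<noteq> z" using adj_m[of x x1] that V by auto
  qed
  have zx: "z \<noteq> x" "m z \<noteq> x" if "x \<in> {x1, x2, x3}" "z \<in> {r, p, q}" for x z
    using xz[OF that] xz(2)[OF that] m_m[of z] that V by auto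
  \<comment> \<open>Patterns, vertex first and mate second: \<open>p\<close> is black-black,
    \<open>r\<close> and \<open>x3\<close> black-white, \<open>x2\<close> white-black,
    \<open>q\<close> and \<open>x1\<close> white-white. The pair of \<open>p\<close> is the only
    black-black one, and \<open>r\<close> is the only black vertex with a white mate not adjacent to
    \<open>p\<close> in the quotient.\<close>
  define S where "S = {r, p, m p, m x2, x3}"
  have cx: "x \<in> S \<longleftrightarrow> x = x3" "m x \<in> S \<longleftrightarrow> x = x2" if x: "x \<in> {x1, x2, x3}" for x
  proof -
    have xV: "x \<in> V" using x V by blast
    have "x \<noteq> r" "x \<noteq> p" "m p \<noteq> x" "m x2 \<noteq> x" using xz(1) zx(2) apart[of x2 x] x by blast+
    then show "x \<in> S \<longleftrightarrow> x = x3" unfolding S_def by auto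
    have "m x \<noteq> r" "m x \<noteq> p" "p \<noteq> x" "m x \<noteq> x3" using xz(2) zx(1) apart[of x x3] x by blast+
    then show "m x \<in> S \<longleftrightarrow> x = x2" using m_eq_iff xV V unfolding S_def by auto
  qed
  have cz: "z \<in> S \<longleftrightarrow> z = r \<or> z = p" "m z \<in> S \<longleftrightarrow> z = p" if z: "z \<in> {r, p, q}" for z
  proof -
    have zV: "z \<in> V" using z V by blast
    have "m p \<noteq> z" "m x2 \<noteq> z" "z \<noteq> x3" using xz(2) zx(1) apart[of p z] z by blast+
    then show "z \<in> S \<longleftrightarrow> z = r \<or> z = p" unfolding S_def by auto
    have "m z \<noteq> r" "m z \<noteq> p" "z \<noteq> x2" "m z \<noteq> x3"
      using zx apart[of z r] apart[of z p] z by blast+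
    then show "m z \<in> S \<longleftrightarrow> z = p" using m_eq_iff zV V unfolding S_def by auto
  qed
  have colour: "r \<in> S" "m r \<notin> S" "p \<in> S" "m p \<in> S" "q \<notin> S" "m q \<notin> S" "x1 \<notin> S" "m x1 \<notin> S"
    "x2 \<notin> S" "m x2 \<in> S" "x3 \<in> S" "m x3 \<notin> S"
    using cx[of x1] cx[of x2] cx[of x3] cz[of r] cz[of p] cz[of q] neq by auto
  have double: "x \<in> {p, m p}" if x: "x \<in> V" "x \<in> S" "m x \<in> S" for x
    using x(2,3) colour mm unfolding S_def by auto
  have ext: "distinguishes_over V A F S" using \<open>F = V\<close> by (simp add: distinguishes_over_def)
  have "distinguishing_set V A S"
  proof (rule distinguishing_setI[OF ext])
    fix a x
    assume a: "a \<in> A" and pres: "\<And>x. x \<in> V \<Longrightarrow> a x \<in> S \<longleftrightarrow> x \<in> S" and x: "x \<in> F"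
    have presm: "m (a x) \<in> S \<longleftrightarrow> m x \<in> S" if "x \<in> V" for x
      using pres[OF m_V[OF that]] A_m[OF a that] by simp
    have ap: "a p \<in> {p, m p}" using double[OF A_V[OF a V(5)]] pres presm colour V by simp
    have "\<not> adj p r" using tri_free[OF V(2)] Nx by simp
    then have "\<not> adj (a p) (a r)" using adj_A[OF a] V by simp
    then have not: "\<not> adj p (a r)" using ap adj_m_left[OF V(5) A_V[OF a r]] by auto
    have "adj x2 p" "adj x3 p" using twins[OF r, of x1] Nr Nx by blast+
    then have "adj p x2" "adj p x3" using adj_sym V by blast+
    then have "a r \<noteq> m x2" "a r \<noteq> x3" using not adj_m V by auto
    moreover have "a r \<in> S" "m (a r) \<notin> S" using pres presm colour V by auto
    ultimately have ar: "a r = r" using colour mm unfolding S_def by auto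
    have "a z \<in> {x1, x2, x3}" if "z \<in> {x1, x2, x3}" for z
      using N_A[OF a r] ar Nr that by auto
    then have "a x1 \<in> {x1, x2, x3}" "a x2 \<in> {x1, x2, x3}" "a x3 \<in> {x1, x2, x3}" by auto
    then have ax: "a x1 = x1" "a x2 = x2" "a x3 = x3"
      using pres presm colour V by (metis insertE singletonD)+
    have "a z \<in> {r, p, q}" if "z \<in> {r, p, q}" for z
      using N_A[OF a V(2)] ax Nx that by auto
    then have "a p \<in> {r, p, q}" "a q \<in> {r, p, q}" by auto
    then have "a p = p" "a q = q"
      using ap apart ar A_eq_iff[OF a] V neq by (metis insertE insertCI singletonD)+
    then show "a x = x" using x ar ax A_m[OF a] V unfolding F_def K_def by auto
  qed
  then show ?thesis by blast
qed

text \<open>The triangle makes \<open>v\<close> and its N-neighbours a K_4, the ladder property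
  copies it to the mates, and connectedness leaves nothing else.\<close>

lemma prism:
  assumes v: "v \<in> V" and x: "x \<in> N v" "y \<in> N v" "y \<in> N x"
  shows "\<exists>K. card K = 4 \<and> V = K \<union> m ` K \<and> K \<inter> m ` K = {} \<and>
      (\<forall>k \<in> K. N k = K - {k} \<and> N (m k) = m ` (K - {k}))"
proof -
  obtain x1 x2 x3 where Nv: "N v = {x1, x2, x3}" using card_N[OF v] by (auto simp: card_3_iff)
  define K where "K = {v, x1, x2, x3}"
  have neq: "x1 \<noteq> x2" "x1 \<noteq> x3" "x2 \<noteq> x3" "v \<notin> {x1, x2, x3}"
    using distinct_N[OF Nv v] N_irrefl[OF v] Nv by auto
  have V: "v \<in> V" "x1 \<in> V" "x2 \<in> V" "x3 \<in> V" using v N_V[OF v] Nv by auto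
  then have KV: "K \<subseteq> V" unfolding K_def by blast
  have card: "card K = 4" using neq unfolding K_def by (auto simp: card_insert_if)
  have NK: "N k = K - {k}" if k: "k \<in> K" for k
  proof -
    have kV: "k \<in> V" using k KV by blast
    have "K - {k} \<subseteq> N k"
      using N_common_invariant[OF v x v] N_sym[OF v] Nv k unfolding K_def by blast
    moreover have "card (K - {k}) = card (N k)" using card k card_N[OF kV] by simp
    moreover have "finite (N k)" using card_N[OF kV] card.infinite by fastforce
    ultimately show ?thesis using card_subset_eq by metis
  qed
  have "K \<union> m ` K = V"
  proof (rule connected)
    show "K \<union> m ` K \<subseteq> V" using KV m_V by blast
    show "K \<union> m ` K \<noteq> {}" unfolding K_def by blast
    show "m z \<in> K \<union> m ` K" if "z \<in> K \<union> m ` K" for z using that KV m_m by fastforce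
    show "N z \<subseteq> K \<union> m ` K" if z: "z \<in> K \<union> m ` K" for z
    proof
      fix u assume u: "u \<in> N z"
      consider "z \<in> K" | k where "k \<in> K" "z = m k" using z by blast
      then show "u \<in> K \<union> m ` K"
      proof cases
        case 1
        then show ?thesis using NK u by blast
      next
        case 2
        then have kV: "k \<in> V" using KV by blast
        have "m u \<in> K" using N_m[OF kV] NK 2 u by blast
        moreover have "u = m (m u)" using m_m N_V[OF m_V[OF kV]] 2 u by simp
        ultimately show ?thesis by blast
      qed
    qed
  qed
  moreover have "K \<inter> m ` K = {}"
    using mate_apart[OF v] unfolding Nv K_def by blast
  moreover have "N (m k) = m ` (K - {k})" if "k \<in> K" for k
    using N_m_eq[of k] NK[OF that] that KV by auto
  ultimately show ?thesis using card NK by blast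
qed

text \<open>A triangle of the quotient either lifts to an N-triangle, giving the prism, or closes
  only through a mate, giving twins: the two sides of the last equation are the full neighbourhoods
  of \<open>x\<close> and \<open>m v\<close>, as \<open>v\<close> is the mate of \<open>m v\<close>.
  Without triangles one of the two preceding colourings applies.\<close>

lemma ladder_alternatives:
  assumes r: "r \<in> V"
  shows "(\<exists>S. distinguishing_set V A S) \<or>
    (\<exists>K. card K = 4 \<and> V = K \<union> m ` K \<and> K \<inter> m ` K = {} \<and>
      (\<forall>k \<in> K. N k = K - {k} \<and> N (m k) = m ` (K - {k}))) \<or>
    (\<exists>v \<in> V. \<exists>x \<in> N v. insert (m x) (N x) = insert v (N (m v)))"
proof (cases "\<exists>v x y. v \<in> V \<and> x \<in> N v \<and> y \<in> N v \<and> adj x y")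
  case True
  then obtain v x y where v: "v \<in> V" and x: "x \<in> N v" "y \<in> N v" and xy: "adj x y" by blast
  have "x \<in> V" using N_V v x by blast
  show ?thesis
  proof (cases "y \<in> N x")
    case True
    then show ?thesis using prism[OF v x] by blast
  next
    case False
    then have my: "m y \<in> N x" using xy unfolding adj_def by blast
    have "x \<noteq> y" using my m_N \<open>x \<in> V\<close> by blast
    then obtain z where Nv: "N v = {x, y, z}" "z \<noteq> x" "z \<noteq> y"
      using card_3_third[OF card_N[OF v] x] by metis
    have V: "y \<in> V" "z \<in> V" using N_V[OF v] Nv by auto
    \<comment> \<open>The relation \<open>m y \<in> N x\<close> is symmetric in the ladder case, so
      holding for \<open>x\<close> and \<open>y\<close> it also holds for \<open>x\<close> and
      \<open>z\<close>.\<close>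
    have "m z \<in> N x"
    proof (rule common_neighbours_invariant[where R = "\<lambda>x y. m y \<in> N x" and v = v and w = v and x = x and y = y])
      show "m (a y) \<in> N (a x)" if "a \<in> A" "x \<in> V" "y \<in> V" "m y \<in> N x" for a x y
        using N_A[OF that(1,2,4)] A_m[OF that(1,3)] by simp
      show "m x \<in> N y" if "x \<in> V" "y \<in> V" "m y \<in> N x" for x y
        using N_m[OF that(2)] N_sym[OF that(1,3)] by blast
    qed (use v x my Nv \<open>x \<noteq> y\<close> in auto)
    moreover have "v \<in> N x" using N_sym v x by blast
    moreover have "v \<noteq> m y" "v \<noteq> m z" "m y \<noteq> m z"
      using mate_apart[OF v] Nv m_eq_iff V by auto
    ultimately have "N x = {v, m y, m z}"
      using card_3_third[OF card_N[OF \<open>x \<in> V\<close>], of v "m y"] my by (metis insertE singletonD)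
    moreover have "N (m v) = {m x, m y, m z}" using N_m_eq[OF v] Nv by simp
    ultimately have "insert (m x) (N x) = insert v (N (m v))" by auto
    then show ?thesis using v x by blast
  qed
next
  case False
  then have tri_free: "\<forall>v \<in> V. \<forall>x \<in> N v. \<forall>y \<in> N v. \<not> adj x y" by blast
  show ?thesis
  proof (cases "\<forall>v \<in> V. \<forall>x \<in> N v. \<forall>y \<in> N v. \<forall>c \<in> N x. adj y c")
    case True
    then show ?thesis by (intro disjI1 distinguishing_set_bipartite[OF tri_free _ r])
  next
    case False
    then obtain v x y c where "v \<in> V" "x \<in> N v" "y \<in> N v" "c \<in> N x" "\<not> adj y c" by blast
    then show ?thesis by (intro disjI1) (rule distinguishing_set_of_private_neighbour[OF tri_free])
  qed
qed

end

lemma (in matched_cubic) cubic_alternatives: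
  assumes r: "r \<in> V"
  shows "(\<exists>S. distinguishing_set V A S) \<or>
    (\<exists>K. card K = 4 \<and> V = K \<union> m ` K \<and> K \<inter> m ` K = {} \<and>
      (\<forall>k \<in> K. N k = K - {k} \<and> N (m k) = m ` (K - {k}))) \<or>
    (\<exists>v \<in> V. \<exists>x \<in> N v. insert (m x) (N x) = insert v (N (m v)))"
proof (cases "\<exists>v x. v \<in> V \<and> x \<in> N v \<and> m x \<in> N (m v)")
  case True
  then have "\<And>v x. v \<in> V \<Longrightarrow> x \<in> N v \<Longrightarrow> m x \<in> N (m v)" using ladder_invariant by blast
  then interpret ladder V A N m by unfold_locales
  show ?thesis using ladder_alternatives[OF r] .
next
  case False
  then have twisted: "\<forall>v \<in> V. \<forall>x \<in> N v. m x \<notin> N (m v)" by blast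
  obtain y where y: "y \<in> N r" using card_N[OF r] by fastforce
  show ?thesis
  proof (cases "N r \<inter> N y = {}")
    case True
    then show ?thesis by (intro disjI1 distinguishing_set_triangle_free[OF twisted r y])
  next
    case False
    then obtain z where "z \<in> N r" "z \<in> N y" by blast
    then show ?thesis by (intro disjI1) (rule distinguishing_set_triangle[OF twisted r y])
  qed
qed

section \<open>Vertex-transitive graphs of valency 4\<close>

lemma digraph_isoI:
  assumes wf: "pair_wf_digraph G" "pair_wf_digraph H"
    and bij: "bij_betw f (pverts G) (pverts H)"
    and arcs: "\<And>u v. u \<in> pverts G \<Longrightarrow> v \<in> pverts G \<Longrightarrow> (f u, f v) \<in> parcs H \<longleftrightarrow> (u, v) \<in> parcs G"
  shows "digraph_iso (with_proj G) (with_proj H)"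
proof -
  let ?h = "\<lparr>iso_verts = f, iso_arcs = map_prod f f, iso_head = snd, iso_tail = fst\<rparr>"
  have inj: "inj_on f (pverts G)" and im: "f ` pverts G = pverts H"
    using bij by (auto simp: bij_betw_def)
  have sub: "parcs G \<subseteq> pverts G \<times> pverts G" "parcs H \<subseteq> pverts H \<times> pverts H"
    using pair_wf_digraph.in_arcsD1 pair_wf_digraph.in_arcsD2 wf by fast+
  have "inj_on (map_prod f f) (parcs G)"
    using map_prod_inj_on[OF inj inj] sub(1) inj_on_subset by blast
  then have "pre_digraph.digraph_isomorphism (with_proj G) ?h"
    using inj wf(1) by (auto simp: pre_digraph.digraph_isomorphism_def wf_digraph_wp_iff)
  moreover have "parcs H = map_prod f f ` parcs G"
  proof
    show "parcs H \<subseteq> map_prod f f ` parcs G"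
    proof
      fix e assume e: "e \<in> parcs H"
      then obtain u v where "e = (f u, f v)" "u \<in> pverts G" "v \<in> pverts G"
        using sub(2) im by blast
      then show "e \<in> map_prod f f ` parcs G" using arcs e by (auto intro: rev_image_eqI)
    qed
    show "map_prod f f ` parcs G \<subseteq> parcs H" using arcs sub(1) by auto
  qed
  then have "with_proj H = app_iso ?h (with_proj G)"
    using im by (simp add: app_iso_def with_proj_def)
  ultimately show ?thesis unfolding digraph_iso_def by blast
qed

lemma distinguishing_number_eq_2:
  assumes S: "distinguishing_set (pverts G) (automorphisms G) S"
    and a: "a \<in> automorphisms G" "a \<noteq> id"
  shows "distinguishing_number G = 2"
  unfolding distinguishing_number_def
proof (rule Least_equality)
  let ?c = "\<lambda>x. if x \<in> S then 1 else 0 :: nat"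
  have "b = id" if b: "b \<in> automorphisms G" "\<forall>v \<in> pverts G. ?c (b v) = ?c v" for b
  proof -
    have "\<forall>x \<in> pverts G. b x \<in> S \<longleftrightarrow> x \<in> S" using b(2) by (auto split: if_splits)
    then have "\<forall>x \<in> pverts G. b x = x" using S b(1) unfolding distinguishes_over_def by blast
    \<comment> \<open>Automorphisms are the identity outside the vertex set, so one that fixes all
      vertices is \<open>id\<close>.\<close>
    moreover have "\<forall>x. x \<notin> pverts G \<longrightarrow> b x = x"
      using b(1) unfolding automorphisms_def permutes_def by blast
    ultimately show ?thesis by (auto simp: fun_eq_iff)
  qed
  then show "\<exists>c. c ` pverts G \<subseteq> {..<2} \<and> distinguishing_colouring G c"
    unfolding distinguishing_colouring_def by (intro exI[of _ ?c]) auto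
  fix k
  assume "\<exists>c. c ` pverts G \<subseteq> {..<k} \<and> distinguishing_colouring G c"
  then obtain c where c: "c ` pverts G \<subseteq> {..<k}" "distinguishing_colouring G c" by blast
  show "2 \<le> k"
  proof (rule ccontr)
    assume "\<not> 2 \<le> k"
    \<comment> \<open>Fewer than two colours leave a colouring constant on the vertices, which the
      non-identity \<open>a\<close> preserves.\<close>
    then have "c x = 0" if "x \<in> pverts G" for x using c(1) that by (auto simp: subset_iff)
    moreover have "a x \<in> pverts G" if "x \<in> pverts G" for x
      using a(1) that permutes_in_image unfolding automorphisms_def by fastforce
    ultimately show False using c(2) a unfolding distinguishing_colouring_def by simp
  qed
qed

locale vertex_transitive_graph =
  fixes G :: "'a pair_pre_digraph"
  assumes pair_graph: "pair_graph G"
    and connected_G: "connected (with_proj G)"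
    and out_degree_4: "\<forall>v \<in> pverts G. out_degree (with_proj G) v = 4"
    and vertex_transitive_G: "vertex_transitive G"
begin

abbreviation V :: "'a set" where "V \<equiv> pverts G"

abbreviation A :: "('a \<Rightarrow> 'a) set" where "A \<equiv> automorphisms G"

definition nbh :: "'a \<Rightarrow> 'a set" where
  "nbh v = {u. (v, u) \<in> parcs G}"

definition fixed :: "'a \<Rightarrow> 'a set" where
  "fixed v = {u \<in> V. \<forall>a \<in> A. a v = v \<longrightarrow> a u = u}"

lemma finite_V: "finite V"
  using pair_graph by (simp add: pair_graph_def pair_digraph_def pair_fin_digraph.pair_finite_verts)

lemma nbh_V: "u \<in> nbh v \<Longrightarrow> u \<in> V"
  using pair_graph pair_wf_digraph.in_arcsD2 unfolding nbh_def pair_graph_def pair_digraph_def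
    pair_fin_digraph_def by fastforce

lemma nbh_irrefl: "v \<notin> nbh v"
  using pair_graph pair_loopfree_digraph.pair_no_loops
  unfolding nbh_def pair_graph_def pair_digraph_def by fastforce

lemma nbh_sym: "u \<in> nbh v \<Longrightarrow> v \<in> nbh u"
  using pair_graph pair_sym_digraph.arcs_symmetric
  unfolding nbh_def pair_graph_def pair_pseudo_graph_def by fastforce

lemma finite_nbh: "finite (nbh v)"
  using finite_subset[OF _ finite_V] nbh_V by blast

lemma card_nbh:
  assumes "v \<in> V"
  shows "card (nbh v) = 4"
proof -
  have "out_arcs (with_proj G) v = Pair v ` nbh v"
    unfolding out_arcs_def nbh_def by auto
  moreover have "card (Pair v ` nbh v) = card (nbh v)" by (simp add: card_image inj_on_def)
  moreover have "card (out_arcs (with_proj G) v) = 4"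
    using out_degree_4 assms unfolding out_degree_def by blast
  ultimately show ?thesis by simp
qed

lemma connected_V:
  assumes "F \<subseteq> V" "F \<noteq> {}" "\<And>v. v \<in> F \<Longrightarrow> nbh v \<subseteq> F"
  shows "F = V"
proof -
  obtain r where r: "r \<in> F" using assms(2) by blast
  have "v \<in> F" if v: "v \<in> V" for v
  proof -
    have "(r, v) \<in> rtrancl_on V ((parcs G)\<^sup>s)"
      using connected_G r assms(1) v unfolding connected_conv by auto
    then show ?thesis
    proof (induction rule: rtrancl_on_induct)
      case (step y z)
      then have "z \<in> nbh y" using nbh_sym unfolding nbh_def symcl_def by auto
      then show ?case using assms(3) step by blast
    qed (rule r)
  qed
  then show ?thesis using assms(1) by blast
qed

lemma A_permutes: "a \<in> A \<Longrightarrow> a permutes V"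
  unfolding automorphisms_def by blast

lemma A_V: "a \<in> A \<Longrightarrow> a v \<in> V \<longleftrightarrow> v \<in> V"
  using A_permutes permutes_in_image by metis

lemma A_eq_iff: "a \<in> A \<Longrightarrow> a x = a y \<longleftrightarrow> x = y"
  using A_permutes permutes_inj by (metis injD)

lemma A_nbh_iff: "a \<in> A \<Longrightarrow> v \<in> V \<Longrightarrow> u \<in> V \<Longrightarrow> a u \<in> nbh (a v) \<longleftrightarrow> u \<in> nbh v"
  unfolding automorphisms_def nbh_def by blast

lemma A_comp: "a \<in> A \<Longrightarrow> b \<in> A \<Longrightarrow> a \<circ> b \<in> A"
  using A_V unfolding automorphisms_def by (auto intro: permutes_compose)

lemma A_inv:
  assumes a: "a \<in> A"
  shows "inv a \<in> A"
proof -
  have "a (inv a u) = u" for u using A_permutes[OF a] permutes_inverses by metis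
  moreover have "inv a permutes V" using A_permutes[OF a] permutes_inv by blast
  moreover have "inv a u \<in> V" if "u \<in> V" for u using calculation that permutes_in_image by metis
  ultimately show ?thesis using a unfolding automorphisms_def by (smt (verit) mem_Collect_eq)
qed

lemma inv_A: "a \<in> A \<Longrightarrow> inv a (a u) = u" "a \<in> A \<Longrightarrow> a (inv a u) = u"
  using A_permutes permutes_inverses by metis+

lemma A_nbh:
  assumes "a \<in> A" "v \<in> V"
  shows "a ` nbh v = nbh (a v)"
proof
  show "a ` nbh v \<subseteq> nbh (a v)" using A_nbh_iff assms nbh_V by blast
  show "nbh (a v) \<subseteq> a ` nbh v"
  proof
    fix u assume u: "u \<in> nbh (a v)"
    then have "a (inv a u) \<in> nbh (a v)" using inv_A(2)[OF assms(1)] by simp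
    moreover have "inv a u \<in> V" using A_V[OF A_inv] assms nbh_V u by blast
    ultimately have "inv a u \<in> nbh v" using A_nbh_iff assms by blast
    then show "u \<in> a ` nbh v" using inv_A(2)[OF assms(1), of u] by (metis imageI)
  qed
qed

lemma transitive: "u \<in> V \<Longrightarrow> v \<in> V \<Longrightarrow> \<exists>a \<in> A. a u = v"
  using vertex_transitive_G unfolding vertex_transitive_def by blast

section \<open>Fixed points of vertex stabilisers\<close>

lemma fixed_V: "fixed v \<subseteq> V"
  unfolding fixed_def by blast

lemma finite_fixed: "finite (fixed v)"
  using finite_subset[OF fixed_V finite_V] .

lemma fixedD: "u \<in> fixed v \<Longrightarrow> a \<in> A \<Longrightarrow> a v = v \<Longrightarrow> a u = u"
  unfolding fixed_def by blast

lemma fixed_self: "v \<in> V \<Longrightarrow> v \<in> fixed v"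
  unfolding fixed_def by blast

lemma A_fixed_subset:
  assumes a: "a \<in> A" and v: "v \<in> V"
  shows "a ` fixed v \<subseteq> fixed (a v)"
proof
  fix w assume "w \<in> a ` fixed v"
  then obtain u where u: "u \<in> fixed v" "w = a u" by blast
  have "b (a u) = a u" if b: "b \<in> A" "b (a v) = a v" for b
  proof -
    \<comment> \<open>Conjugation by \<open>a\<close> carries the stabiliser of \<open>a v\<close>
      to that of \<open>v\<close>.\<close>
    have "inv a \<circ> (b \<circ> a) \<in> A" using A_comp A_inv a b by blast
    then have "inv a (b (a u)) = u" using fixedD[OF u(1)] b(2) inv_A(1)[OF a] by fastforce
    then show ?thesis using inv_A(2)[OF a] by metis
  qed
  then show "w \<in> fixed (a v)" using u A_V[OF a] fixed_V unfolding fixed_def by blast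
qed

lemma A_fixed:
  assumes a: "a \<in> A" and v: "v \<in> V"
  shows "a ` fixed v = fixed (a v)"
proof
  show "fixed (a v) \<subseteq> a ` fixed v"
  proof
    fix u assume "u \<in> fixed (a v)"
    then have "inv a u \<in> fixed (inv a (a v))"
      using A_fixed_subset[OF A_inv[OF a]] A_V[OF a] v by blast
    then have "inv a u \<in> fixed v" using inv_A(1)[OF a] by simp
    then show "u \<in> a ` fixed v" using inv_A(2)[OF a, of u] by (metis imageI)
  qed
qed (rule A_fixed_subset[OF a v])

text \<open>Conjugate stabilisers fix equally many vertices, so the inclusion is an equality.\<close>

lemma fixed_eq:
  assumes v: "v \<in> V" and u: "u \<in> fixed v"
  shows "fixed u = fixed v"
proof -
  have uV: "u \<in> V" using u fixed_V by blast
  have "fixed u \<subseteq> fixed v" using u unfolding fixed_def by blast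
  moreover obtain a where "a \<in> A" "a u = v" using transitive uV v by blast
  then have "card (fixed u) = card (fixed v)"
    using A_fixed[of a u] uV A_eq_iff card_image[of a "fixed u"] by (metis inj_onI)
  ultimately show ?thesis using card_subset_eq finite_fixed by metis
qed

lemma fixed_sym: "v \<in> V \<Longrightarrow> u \<in> fixed v \<Longrightarrow> v \<in> fixed u"
  using fixed_eq fixed_self by metis

lemma A_fixed_nbh:
  assumes "a \<in> A" "v \<in> V"
  shows "a ` (nbh v \<inter> fixed v) = nbh (a v) \<inter> fixed (a v)"
  using A_fixed A_nbh assms A_eq_iff image_Int[of a] by (metis injI)

lemma card_fixed_nbh:
  assumes "u \<in> V" "v \<in> V"
  shows "card (nbh u \<inter> fixed u) = card (nbh v \<inter> fixed v)"
proof -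
  obtain a where a: "a \<in> A" "a u = v" using transitive assms by blast
  then have "inj_on a (nbh u \<inter> fixed u)" using A_eq_iff by (metis inj_onI)
  then show ?thesis using A_fixed_nbh[OF a(1) assms(1)] card_image a(2) by metis
qed

text \<open>The orbit counted by \<open>edge_type\<close> contains \<open>u\<close> itself, through
  the identity, so size 1 means that the stabiliser of \<open>v\<close> fixes
  \<open>u\<close>.\<close>

lemma fixed_neighbour:
  assumes "(u, v) \<in> parcs G" "edge_type G u v = 1"
  shows "u \<in> nbh v \<inter> fixed v"
proof -
  have "id \<in> A" unfolding automorphisms_def by (auto intro: permutes_id)
  then have "u \<in> {a u | a. a \<in> vertex_stabiliser G v}"
    unfolding vertex_stabiliser_def by (auto intro!: exI[of _ id])
  moreover obtain w where "{a u | a. a \<in> vertex_stabiliser G v} = {w}"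
    using assms(2) unfolding edge_type_def by (rule card_1_singletonE)
  ultimately have w: "{a u | a. a \<in> vertex_stabiliser G v} = {u}" by auto
  have "u \<in> nbh v" using assms(1) nbh_sym unfolding nbh_def by blast
  moreover have "a u = u" if "a \<in> A" "a v = v" for a
    using w that unfolding vertex_stabiliser_def by blast
  ultimately show ?thesis using nbh_V unfolding fixed_def by blast
qed

text \<open>Exchanging twins changes no neighbourhood, and since adjacency is symmetric the exchange
  can be made in both of its arguments.\<close>

lemma transpose_twins:
  assumes V: "x \<in> V" "y \<in> V" and twins: "nbh x = nbh y"
  shows "Transposition.transpose x y \<in> A"
proof -
  let ?t = "Transposition.transpose x y"
  have perm: "?t permutes V" using V permutes_swap_id by fastforce
  have t: "nbh (?t u) = nbh u" for u using twins by (simp add: Transposition.transpose_def)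
  have "w \<in> nbh (?t u) \<longleftrightarrow> ?t w \<in> nbh (?t u)" for u w
    using nbh_sym t by metis
  then have "?t w \<in> nbh (?t u) \<longleftrightarrow> w \<in> nbh u" for u w using t by metis
  then show ?thesis using perm unfolding automorphisms_def nbh_def by simp
qed

text \<open>
  The classes \<^term>\<open>fixed v\<close> are blocks on which the automorphisms act semiregularly. A root class
  is recognised by having two black vertices, and its only white vertex is then fixed.
\<close>

lemma distinguishing_set_two_fixed:
  assumes two: "\<forall>v \<in> V. 2 \<le> card (nbh v \<inter> fixed v)" and r: "r \<in> V"
  shows "\<exists>S. distinguishing_set V A S"
proof -
  let ?I = "\<lambda>F. F \<noteq> {} \<and> (\<forall>x \<in> F. fixed x \<subseteq> F)"
  let ?P = "\<lambda>_ T. \<forall>y \<in> T. \<forall>z \<in> T. y = z"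
  have "\<exists>S. S \<inter> fixed r = fixed r - {r} \<and> (\<forall>x \<in> V - fixed r. ?P x (S \<inter> fixed x)) \<and>
    distinguishes_over V A (fixed r) S"
  proof (rule extend_set[where I = ?I and P = ?P, OF finite_V])
    fix F assume F: "?I F" "F \<subset> V"
    then obtain w where w: "w \<in> F" "\<not> nbh w \<subseteq> F" using connected_V[of F] by blast
    have wV: "w \<in> V" using w F by blast
    define K where "K = nbh w - F"
    \<comment> \<open>\<open>fixed w\<close> lies in \<open>F\<close>, so only neighbours not fixed
      at \<open>w\<close> are new, and there are at most two of them.\<close>
    have "card K \<le> card (nbh w - nbh w \<inter> fixed w)"
      unfolding K_def using w(1) F(1) finite_nbh by (intro card_mono) auto
    also have "\<dots> \<le> 2" using two wV card_nbh[OF wV] finite_nbh by (subst card_Diff_subset) auto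
    finally have "card K \<le> 2" .
    moreover have "K \<noteq> {}" "finite K" using w(2) finite_nbh unfolding K_def by auto
    ultimately have "card K = 1 \<or> card K = 2"
      using card_gt_0_iff[of K] by linarith
    then obtain x y where K: "K = {x, y}" by (auto simp: card_1_singleton_iff card_2_iff)
    have V: "x \<in> V" "y \<in> V" "x \<notin> F" "y \<notin> F" using K nbh_V unfolding K_def by auto
    \<comment> \<open>Here \<open>x = y\<close> if only one neighbour is new. Blackening only
      \<open>x\<close> tells \<open>x\<close> from \<open>y\<close>, and once these are fixed so are
      their whole classes.\<close>
    define D where "D = fixed x \<union> fixed y"
    have "D \<noteq> {}" using fixed_self V unfolding D_def by blast
    moreover have "D \<subseteq> V - F"
      using F(1) fixed_V fixed_sym V unfolding D_def by blast
    moreover have D: "fixed z \<subseteq> D" if "z \<in> D" for z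
      using that fixed_eq V unfolding D_def by blast
    moreover have "?I (F \<union> D)" using F(1) D by blast
    moreover have "{x} \<subseteq> D" using fixed_self V unfolding D_def by blast
    moreover have "\<forall>a \<in> A. \<forall>S. S \<inter> D = {x} \<longrightarrow> (\<forall>z \<in> V. a z \<in> S \<longleftrightarrow> z \<in> S) \<longrightarrow>
        (\<forall>z \<in> F. a z = z) \<longrightarrow> (\<forall>z \<in> D. a z = z)"
    proof (intro ballI allI impI)
      fix a S z
      assume a: "a \<in> A" and S: "S \<inter> D = {x}" and pres: "\<forall>z \<in> V. a z \<in> S \<longleftrightarrow> z \<in> S"
        and fixF: "\<forall>z \<in> F. a z = z" and z: "z \<in> D"
      have xD: "x \<in> D" "y \<in> D" using fixed_self V unfolding D_def by auto
      have aK: "a u \<in> K" if "u \<in> K" for u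
      proof -
        have u: "u \<in> nbh w" "u \<notin> F" using that unfolding K_def by auto
        have "a u \<in> nbh w" using A_nbh[OF a wV] u fixF w(1) by auto
        moreover have "a u \<notin> F" using fixF A_eq_iff[OF a] u by metis
        ultimately show ?thesis unfolding K_def by blast
      qed
      have "a x \<in> S" using pres S V by blast
      moreover have "a x \<in> {x, y}" using aK K by blast
      ultimately have ax: "a x = x" using S xD by blast
      moreover have "a y \<in> {x, y}" using aK K by blast
      ultimately have "a y = y" using A_eq_iff[OF a] by (metis insertE singletonD)
      then show "a z = z" using ax z fixedD[OF _ a] unfolding D_def by blast
    qed
    ultimately show "\<exists>D d. D \<noteq> {} \<and> D \<subseteq> V - F \<and> ?I (F \<union> D) \<and> d \<subseteq> D \<and>
        (\<forall>x \<in> D. fixed x \<subseteq> D \<and> ?P x (d \<inter> fixed x)) \<and>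
        (\<forall>a \<in> A. \<forall>S. S \<inter> D = d \<longrightarrow> (\<forall>x \<in> V. a x \<in> S \<longleftrightarrow> x \<in> S) \<longrightarrow>
           (\<forall>x \<in> F. a x = x) \<longrightarrow> (\<forall>x \<in> D. a x = x))"
      by (intro exI[of _ D] exI[of _ "{x}"] conjI ballI) simp_all
  next
    show "?I (fixed r)" using fixed_self fixed_eq r by blast
  qed (use fixed_V in auto)
  then obtain S where S: "S \<inter> fixed r = fixed r - {r}"
    and few: "\<And>x y z. x \<in> V - fixed r \<Longrightarrow> y \<in> S \<inter> fixed x \<Longrightarrow> z \<in> S \<inter> fixed x \<Longrightarrow> y = z"
    and ext: "distinguishes_over V A (fixed r) S" by blast
  have "distinguishing_set V A S"
  proof (rule distinguishing_setI[OF ext])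
    fix a x
    assume a: "a \<in> A" and pres: "\<And>x. x \<in> V \<Longrightarrow> a x \<in> S \<longleftrightarrow> x \<in> S" and x: "x \<in> fixed r"
    have "\<not> is_singleton (nbh r \<inter> fixed r)" "nbh r \<inter> fixed r \<noteq> {}"
      using two r by (auto simp: is_singleton_altdef)
    then obtain u w where uw: "u \<in> nbh r \<inter> fixed r" "w \<in> nbh r \<inter> fixed r" "u \<noteq> w"
      by (metis ex_in_conv is_singletonI')
    then have "u \<in> S" "w \<in> S" using S nbh_irrefl by blast+
    then have "a u \<in> S \<inter> fixed (a r)" "a w \<in> S \<inter> fixed (a r)"
      using pres uw A_fixed[OF a r] nbh_V by blast+
    then have "a r \<notin> V - fixed r" using few A_eq_iff[OF a] uw(3) by blast
    then have "a r \<in> fixed r" using A_V[OF a] r by blast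
    moreover have "a r \<notin> S" using pres[OF r] S fixed_self[OF r] by blast
    ultimately have "a r = r" using S by blast
    then show "a x = x" using fixedD[OF x a] by blast
  qed
  then show ?thesis by blast
qed

text \<open>Symmetry of \<open>fixed\<close> turns the unique fixed neighbour into a perfect
  matching, with which automorphisms commute because they respect \<open>fixed\<close>.\<close>

lemma matched_cubic_one_fixed:
  assumes one: "\<forall>v \<in> V. card (nbh v \<inter> fixed v) = 1"
  defines "m \<equiv> \<lambda>v. the_elem (nbh v \<inter> fixed v)"
  defines "N \<equiv> \<lambda>v. nbh v - {m v}"
  shows "matched_cubic V A N m" and "\<And>v. v \<in> V \<Longrightarrow> nbh v \<inter> fixed v = {m v}"
proof -
  show m: "nbh v \<inter> fixed v = {m v}" if "v \<in> V" for v
    using one that unfolding m_def by (metis card_1_singletonE the_elem_eq)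
  have mI: "u = m v" if "v \<in> V" "u \<in> nbh v" "u \<in> fixed v" for u v
    using m[OF that(1)] that by blast
  have mV: "m v \<in> V" and mm: "m (m v) = v" if v: "v \<in> V" for v
  proof -
    have mv: "m v \<in> nbh v" "m v \<in> fixed v" using m[OF v] by auto
    then show "m v \<in> V" using nbh_V by blast
    then show "m (m v) = v" using mI nbh_sym[OF mv(1)] fixed_sym[OF v mv(2)] by metis
  qed
  have Am: "a (m v) = m (a v)" if "a \<in> A" "v \<in> V" for a v
    using A_fixed_nbh[OF that] m[OF that(2)] m[of "a v"] A_V[OF that(1)] that(2) by auto
  have AN: "a ` N v = N (a v)" if "a \<in> A" "v \<in> V" for a v
  proof -
    have "inj a" using A_eq_iff[OF that(1)] by (auto intro: injI)
    then have "a ` N v = a ` nbh v - {a (m v)}" unfolding N_def by (simp add: image_set_diff)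
    then show ?thesis using A_nbh[OF that] Am[OF that] unfolding N_def by simp
  qed
  have card_N: "card (N v) = 3" if "v \<in> V" for v
    using card_nbh[OF that] finite_nbh m[OF that] unfolding N_def by (subst card_Diff_singleton) auto
  \<comment> \<open>The stabiliser of \<open>v\<close> fixes no element of \<open>N v\<close>, and
    three elements cannot split into several orbits of size at least 2: if \<open>x\<close> and
    \<open>y\<close> were in different orbits, both would have to move to \<open>z\<close>.\<close>
  have local_trans: "\<exists>a \<in> A. a v = v \<and> a x = y" if v: "v \<in> V" and x: "x \<in> N v" and y: "y \<in> N v" for v x y
  proof (rule ccontr)
    assume no: "\<not> ?thesis"
    have "id \<in> A" unfolding automorphisms_def by (auto intro: permutes_id)
    then have "x \<noteq> y" using no by fastforce
    then obtain z where Nv: "N v = {x, y, z}" using card_3_third[OF card_N[OF v] x y] by metis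
    have move: "\<exists>a \<in> A. a v = v \<and> a u \<noteq> u" if "u \<in> N v" for u
      using that m[OF v] nbh_V[of u v] unfolding N_def fixed_def by blast
    obtain a b where a: "a \<in> A" "a v = v" "a x \<noteq> x" and b: "b \<in> A" "b v = v" "b y \<noteq> y"
      using move x y by blast
    have "a x \<in> N v" "b y \<in> N v" using AN[OF a(1) v] AN[OF b(1) v] a b x y by auto
    then have "a x = z" and b_y: "b y = x \<or> b y = z" using a b Nv no by auto
    have ib: "inv b \<in> A" "inv b v = v" using A_inv[OF b(1)] inv_A(1)[OF b(1), of v] b(2) by auto
    have "b y \<noteq> x" using no ib inv_A(1)[OF b(1), of y] by metis
    then have "inv b z = y" using b_y inv_A(1)[OF b(1), of y] by auto
    then have "(inv b \<circ> a) v = v \<and> (inv b \<circ> a) x = y" using a(2) ib(2) \<open>a x = z\<close> by simp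
    then show False using no A_comp[OF ib(1) a(1)] by blast
  qed
  show "matched_cubic V A N m"
  proof
    show "finite V" by (rule finite_V)
    show "u \<in> V" if "v \<in> V" "u \<in> N v" for u v using that nbh_V unfolding N_def by blast
    show "card (N v) = 3" if "v \<in> V" for v using card_N[OF that] .
    show "v \<in> N u" if "v \<in> V" "u \<in> N v" for u v
    proof -
      have u: "u \<in> nbh v" "u \<noteq> m v" "u \<in> V" using that nbh_V unfolding N_def by auto
      then have "v \<noteq> m u" using mm[of u] by auto
      then show ?thesis using nbh_sym u unfolding N_def by blast
    qed
    show "v \<notin> N v" for v using nbh_irrefl unfolding N_def by blast
    show "m v \<in> V" "m (m v) = v" if "v \<in> V" for v by (fact mV[OF that], fact mm[OF that])
    show "m v \<noteq> v" if "v \<in> V" for v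
    proof
      assume "m v = v"
      then have "v \<in> nbh v" using m[OF that] by auto
      then show False using nbh_irrefl by blast
    qed
    show "m v \<notin> N v" for v unfolding N_def by blast
    show "a v \<in> V" if "a \<in> A" "v \<in> V" for a v using A_V that by blast
    show "inj_on a V" if "a \<in> A" for a using A_eq_iff[OF that] by (auto intro: inj_onI)
    show "a ` N v = N (a v)" if "a \<in> A" "v \<in> V" for a v using AN[OF that] .
    show "a (m v) = m (a v)" if "a \<in> A" "v \<in> V" for a v using Am[OF that] .
    show "\<exists>a \<in> A. a v = w \<and> a x = y" if v: "v \<in> V" and x: "x \<in> N v" and w: "w \<in> V" and y: "y \<in> N w"
      for v x w y
    proof -
      obtain b where b: "b \<in> A" "b v = w" using transitive v w by blast
      then have "b x \<in> N w" using AN[OF b(1) v] x by blast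
      then obtain c where "c \<in> A" "c w = w" "c (b x) = y" using local_trans w y by blast
      then show ?thesis using A_comp[of c b] b by (intro bexI[of _ "c \<circ> b"]) auto
    qed
    show "F = V" if "F \<subseteq> V" "F \<noteq> {}" "\<And>v. v \<in> F \<Longrightarrow> N v \<subseteq> F" "\<And>v. v \<in> F \<Longrightarrow> m v \<in> F" for F
    proof (rule connected_V[OF that(1,2)])
      show "nbh v \<subseteq> F" if "v \<in> F" for v
        using \<open>\<And>v. v \<in> F \<Longrightarrow> N v \<subseteq> F\<close>[OF that] \<open>\<And>v. v \<in> F \<Longrightarrow> m v \<in> F\<close>[OF that]
        unfolding N_def by blast
    qed
  qed
qed

text \<open>Transposing twins \<open>x\<close> and \<open>y\<close> would be an automorphism that
  fixes \<open>v\<close> and yet moves \<open>y\<close>, a vertex fixed at \<open>v\<close>.\<close>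

lemma twin_free:
  assumes "v \<in> V" "x \<in> nbh v" "y \<in> fixed v" "x \<noteq> y" "y \<noteq> v"
  shows "nbh x \<noteq> nbh y"
proof
  assume "nbh x = nbh y"
  then have "Transposition.transpose x y \<in> A"
    using transpose_twins assms nbh_V fixed_V by blast
  moreover have "Transposition.transpose x y v = v"
    using assms nbh_irrefl by (intro transpose_apply_other) auto
  ultimately have "Transposition.transpose x y y = y" using fixedD assms(3) by blast
  then show False using assms(4) by simp
qed

lemma digraph_iso_K4_prism:
  assumes K: "card K = 4" "V = K \<union> m ` K" "K \<inter> m ` K = {}" and inj: "inj_on m K"
    and nbhK: "\<And>k. k \<in> K \<Longrightarrow> nbh k = insert (m k) (K - {k})"
    and nbhM: "\<And>k. k \<in> K \<Longrightarrow> nbh (m k) = insert k (m ` (K - {k}))"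
  shows "digraph_iso (with_proj G) (with_proj (complete_graph 4 \<box> complete_graph 2))"
proof -
  have "finite K" using K(1) card.infinite by fastforce
  then obtain h where h: "bij_betw h K {..<4 :: nat}"
    using K(1) by (metis bij_betw_iff_card card_lessThan finite_lessThan)
  define g where "g = the_inv_into K m"
  have g: "g (m k) = k" if "k \<in> K" for k
    unfolding g_def using the_inv_into_f_f[OF inj that] .
  \<comment> \<open>\<open>K\<close> becomes one layer of the product and its mates the other, each
    vertex lying over its mate.\<close>
  define f where "f x = (if x \<in> K then (h x, 0 :: nat) else (h (g x), 1))" for x
  have fK: "f k = (h k, 0)" and fm: "f (m k) = (h k, 1)" if "k \<in> K" for k
    using that K(3) g unfolding f_def by auto
  have hK: "h k < 4" if "k \<in> K" for k using bij_betwE[OF h] that by blast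
  have h_eq: "h k = h l \<longleftrightarrow> k = l" if "k \<in> K" "l \<in> K" for k l
    using h that by (auto simp: bij_betw_def dest: inj_onD)
  let ?H = "complete_graph 4 \<box> complete_graph 2"
  have H: "((i, s), (j, t)) \<in> parcs ?H \<longleftrightarrow> i < 4 \<and> j < 4 \<and> s < 2 \<and> t < 2 \<and> (i = j \<and> s \<noteq> t \<or> i \<noteq> j \<and> s = t)"
    for i s j t
    unfolding cartesian_product_def complete_graph_def by auto
  show ?thesis
  proof (rule digraph_isoI)
    show "pair_wf_digraph G"
      using pair_graph by (simp add: pair_graph_def pair_digraph_def pair_fin_digraph_def)
    show "pair_wf_digraph ?H"
      by unfold_locales (auto simp: cartesian_product_def complete_graph_def)
    show "bij_betw f V (pverts ?H)"
    proof (rule bij_betw_imageI)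
      show "inj_on f V"
      proof (rule inj_onI)
        fix x y assume "x \<in> V" "y \<in> V" and e: "f x = f y"
        then obtain k l where kl: "k \<in> K" "l \<in> K" and xy: "x = k \<or> x = m k" "y = l \<or> y = m l"
          unfolding K(2) by blast
        have "k = l" using xy e fK[OF kl(1)] fm[OF kl(1)] fK[OF kl(2)] fm[OF kl(2)] h_eq[OF kl] by auto
        then show "x = y" using xy e fK[OF kl(1)] fm[OF kl(1)] by auto
      qed
      have "f ` V = (\<lambda>k. (h k, 0)) ` K \<union> (\<lambda>k. (h k, 1)) ` K"
        unfolding K(2) image_Un image_image using fK fm by (simp cong: image_cong)
      also have "\<dots> = h ` K \<times> {0} \<union> h ` K \<times> {1}" by auto
      also have "\<dots> = {..<4} \<times> {..<2}" using h by (auto simp: bij_betw_def)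
      finally show "f ` V = pverts ?H" by (simp add: cartesian_product_def complete_graph_def)
    qed
    have m_eq: "m k = m l \<longleftrightarrow> k = l" if "k \<in> K" "l \<in> K" for k l
      using inj that by (auto dest: inj_onD)
    have mK: "m k \<notin> K" if "k \<in> K" for k using K(3) that by blast
    fix u v assume "u \<in> V" "v \<in> V"
    then obtain k l where kl: "k \<in> K" "l \<in> K" and uv: "u = k \<or> u = m k" "v = l \<or> v = m l"
      unfolding K(2) by blast
    have arc: "(u, v) \<in> parcs G \<longleftrightarrow> v \<in> nbh u" for u v unfolding nbh_def by simp
    have "l \<notin> m ` (K - {k})" using K(3) kl(2) by blast
    moreover have "m l \<in> m ` (K - {k}) \<longleftrightarrow> k \<noteq> l" using m_eq kl by auto
    moreover have "m l \<notin> K" "m k \<notin> K" using mK kl by auto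
    ultimately have "(k, l) \<in> parcs G \<longleftrightarrow> k \<noteq> l" "(k, m l) \<in> parcs G \<longleftrightarrow> k = l"
      "(m k, l) \<in> parcs G \<longleftrightarrow> k = l" "(m k, m l) \<in> parcs G \<longleftrightarrow> k \<noteq> l"
      unfolding arc nbhK[OF kl(1)] nbhM[OF kl(1)] using kl m_eq[OF kl] by auto
    then show "(f u, f v) \<in> parcs ?H \<longleftrightarrow> (u, v) \<in> parcs G"
      using uv by (elim disjE) (simp_all add: H fK fm kl hK h_eq)
  qed
qed

lemma distinguishing_set_exists:
  assumes r: "r \<in> V" and u: "u \<in> nbh r \<inter> fixed r"
    and no_iso: "\<not> digraph_iso (with_proj G) (with_proj (complete_graph 4 \<box> complete_graph 2))"
  shows "\<exists>S. distinguishing_set V A S"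
proof (cases "card (nbh r \<inter> fixed r) = 1")
  case False
  moreover have "card (nbh r \<inter> fixed r) \<noteq> 0" using u finite_nbh by auto
  ultimately have "2 \<le> card (nbh r \<inter> fixed r)" by linarith
  then have "\<forall>v \<in> V. 2 \<le> card (nbh v \<inter> fixed v)" using card_fixed_nbh[OF r] by metis
  then show ?thesis using distinguishing_set_two_fixed r by blast
next
  case True
  define m where "m v = the_elem (nbh v \<inter> fixed v)" for v
  define N where "N v = nbh v - {m v}" for v
  have one: "\<forall>v \<in> V. card (nbh v \<inter> fixed v) = 1" using card_fixed_nbh[OF r] True by metis
  interpret matched_cubic V A N m
    using matched_cubic_one_fixed(1)[OF one] unfolding N_def m_def .
  have m: "nbh v \<inter> fixed v = {m v}" if "v \<in> V" for v
    using matched_cubic_one_fixed(2)[OF one that] unfolding m_def .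
  have nbh: "nbh v = insert (m v) (N v)" if "v \<in> V" for v
    using m[OF that] unfolding N_def by blast
  show ?thesis
    using cubic_alternatives[OF r]
  proof (elim disjE)
    assume "\<exists>K. card K = 4 \<and> V = K \<union> m ` K \<and> K \<inter> m ` K = {} \<and>
      (\<forall>k \<in> K. N k = K - {k} \<and> N (m k) = m ` (K - {k}))"
    then obtain K where *: "card K = 4 \<and> V = K \<union> m ` K \<and> K \<inter> m ` K = {} \<and>
      (\<forall>k \<in> K. N k = K - {k} \<and> N (m k) = m ` (K - {k}))" ..
    note K = *[THEN conjunct1] *[THEN conjunct2, THEN conjunct1]
      *[THEN conjunct2, THEN conjunct2, THEN conjunct1]
    have N: "N k = K - {k}" "N (m k) = m ` (K - {k})" if "k \<in> K" for k
      using *[THEN conjunct2, THEN conjunct2, THEN conjunct2] that by auto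
    have KV: "k \<in> V" if "k \<in> K" for k using K(2) that by blast
    have "digraph_iso (with_proj G) (with_proj (complete_graph 4 \<box> complete_graph 2))"
    proof (rule digraph_iso_K4_prism[OF K])
      show "inj_on m K" using m_eq_iff KV by (auto intro: inj_onI)
      show "nbh k = insert (m k) (K - {k})" "nbh (m k) = insert k (m ` (K - {k}))" if "k \<in> K" for k
        using nbh[OF KV[OF that]] nbh[OF m_V[OF KV[OF that]]] m_m[OF KV[OF that]] N[OF that] by auto
    qed
    then show ?thesis using no_iso by blast
  next
    assume "\<exists>v \<in> V. \<exists>x \<in> N v. insert (m x) (N x) = insert v (N (m v))"
    then obtain v x where v: "v \<in> V" and x: "x \<in> N v" and e: "insert (m x) (N x) = insert v (N (m v))"
      by blast
    \<comment> \<open>\<open>x\<close> and \<open>m v\<close> would be twins, although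
      \<open>m v\<close> is fixed at \<open>v\<close>.\<close>
    have "nbh x = nbh (m v)"
      using e nbh[OF N_V[OF v x]] nbh[OF m_V[OF v]] m_m[OF v] by simp
    then show ?thesis
      using twin_free[OF v, of x "m v"] x m[OF v] m_neq[OF v] unfolding N_def by blast
  qed
qed

end

theorem theorem3p4:
  fixes G :: "'a pair_pre_digraph"
  assumes "pair_graph G"
    and "connected (with_proj G)"
    and "\<forall>v \<in> pverts G. out_degree (with_proj G) v = 4"
    and "vertex_transitive G"
    and "\<exists>(u, v) \<in> parcs G. edge_type G u v = 1"
    and "\<not> digraph_iso (with_proj G) (with_proj (complete_graph 4 \<box> complete_graph 2))"
  shows "distinguishing_number G = 2"
proof -
  interpret vertex_transitive_graph G using assms(1-4) by (rule vertex_transitive_graph.intro)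
  obtain u v where uv: "(u, v) \<in> parcs G" "edge_type G u v = 1" using assms(5) by blast
  have u: "u \<in> nbh v \<inter> fixed v" by (rule fixed_neighbour[OF uv])
  have V: "u \<in> V" "v \<in> V" using u nbh_V nbh_sym by blast+
  obtain S where "distinguishing_set V A S"
    using distinguishing_set_exists[OF V(2) u assms(6)] by blast
  \<comment> \<open>Transitivity along an edge supplies the non-identity automorphism that rules out
    a single colour.\<close>
  moreover obtain a where "a \<in> A" "a u = v" using transitive V by blast
  moreover then have "a \<noteq> id" using u nbh_irrefl by auto
  ultimately show ?thesis using distinguishing_number_eq_2 by blast
qed

end
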